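(* Let $q$ be a power of the prime $p$ and $m\ge 1$. Let $\mathrm{U}_m(q)\le \mathrm{GL}_m(q^2)$ be the isometry group of a non-degenerate unitary (Hermitian) form on $V=\mathbb{F}_{q^2}^m$, and let $\mathrm{AU}_m(q)=V\rtimes \mathrm{U}_m(q)$ act on $V$ via $u\mapsto ua+v$. Then the proportion of elements of $\mathrm{AU}_m(q)$ that are derangements of $p$-power order is $$\frac{1}{q^m(q+1)}\sum_{i=1}^m\frac{(-1)^i\left((-q)^{i+1}-1\right)}{(-q)^{i(i+1)/2}\,(-1/q)_{m-i}}.$$
   Context: A derangement is an element with no fixed points on $V$. For a non-negative integer $j$ and an indeterminate (or number) $x$, $(x)_0=1$ and $(x)_j=\prod_{i=1}^j(1-x^i)$ for $j\ge1$. *)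

theory Defs
  imports "HOL-Analysis.Analysis" "HOL-Algebra.Multiplicative_Group"
begin

text \<open>Over a field of order \<open>q\<^sup>2\<close> the conjugation is \<open>x \<mapsto> x ^ q\<close>; conjugate-linearity in the
  second argument follows from the two conditions.\<close>

definition hermitian_form :: "nat \<Rightarrow> ('a::field^'n \<Rightarrow> 'a^'n \<Rightarrow> 'a) \<Rightarrow> bool" where
  "hermitian_form q B \<longleftrightarrow>
     (\<forall>v. Vector_Spaces.linear (*s) (*) (\<lambda>u. B u v)) \<and> (\<forall>u v. B v u = B u v ^ q)"

definition nondegenerate :: "('a::field^'n \<Rightarrow> 'a^'n \<Rightarrow> 'a) \<Rightarrow> bool" where
  "nondegenerate B \<longleftrightarrow> (\<forall>u. (\<forall>v. B u v = 0) \<longrightarrow> u = 0)"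

text \<open>Matrices act on row vectors from the right throughout.\<close>

definition isometries :: "('a::field^'n \<Rightarrow> 'a^'n \<Rightarrow> 'a) \<Rightarrow> ('a^'n^'n) set" where
  "isometries B = {a. invertible a \<and> (\<forall>u v. B (u v* a) (v v* a) = B u v)}"

text \<open>The semidirect product of the translations with the isometry group: the pair \<open>(v, a)\<close> stands
  for the map \<open>u \<mapsto> ua + v\<close>, and products are composed from left to right.\<close>

definition affine_isometry_group ::
    "('a::field^'n \<Rightarrow> 'a^'n \<Rightarrow> 'a) \<Rightarrow> (('a^'n) \<times> ('a^'n^'n)) monoid" where
  "affine_isometry_group B =
     \<lparr>carrier = UNIV \<times> isometries B,
      mult = (\<lambda>(v, a) (w, b). (v v* b + w, a ** b)),
      one = (0, mat 1)\<rparr>"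

definition affine_action :: "'a::field^'n \<Rightarrow> (('a^'n) \<times> ('a^'n^'n)) \<Rightarrow> 'a^'n" where
  "affine_action u = (\<lambda>(v, a). u v* a + v)"

definition derangement :: "(('a::field^'n) \<times> ('a^'n^'n)) \<Rightarrow> bool" where
  "derangement g \<longleftrightarrow> (\<forall>u. affine_action u g \<noteq> u)"

definition q_pochhammer :: "real \<Rightarrow> nat \<Rightarrow> real" where
  "q_pochhammer x j = (\<Prod>i=1..j. 1 - x ^ i)"

lemma affine_action_mult:
  "affine_action u (g \<otimes>\<^bsub>affine_isometry_group B\<^esub> h) = affine_action (affine_action u g) h"
  by (auto simp: affine_action_def affine_isometry_group_def vector_matrix_left_distrib
      vector_matrix_mul_assoc split: prod.splits)

lemma group_affine_isometry_group: "group (affine_isometry_group B)"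
proof (rule groupI)
  fix x assume x: "x \<in> carrier (affine_isometry_group B)"
  obtain v a where va: "x = (v, a)" by (cases x)
  have a: "invertible a" "\<And>u w. B (u v* a) (w v* a) = B u w"
    using x by (auto simp: va affine_isometry_group_def isometries_def)
  obtain b where ab: "a ** b = mat 1" "b ** a = mat 1"
    using a(1) by (auto simp: invertible_def)
  have "B (u v* b) (w v* b) = B u w" for u w
    using a(2)[of "u v* b" "w v* b"] by (simp add: vector_matrix_mul_assoc ab)
  moreover have "invertible b" using ab by (auto simp: invertible_def)
  moreover have "- (v v* b) v* a + v = 0"
    by (metis ab(2) add.left_inverse vector_matrix_left_distrib vector_matrix_mul_assoc
        vector_matrix_mul_rid add_cancel_left_left)
  ultimately show "\<exists>y\<in>carrier (affine_isometry_group B).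
      y \<otimes>\<^bsub>affine_isometry_group B\<^esub> x = \<one>\<^bsub>affine_isometry_group B\<^esub>"
    by (intro bexI[of _ "(- (v v* b), b)"])
      (auto simp: affine_isometry_group_def isometries_def va ab)
qed (auto simp: affine_isometry_group_def isometries_def invertible_mult vector_matrix_left_distrib
    vector_matrix_mul_assoc[symmetric] matrix_mul_assoc invertible_def[of "mat 1"] add.assoc
    intro: exI[of _ "mat 1"])

end

theory Submission
  imports Defs "HOL-Computational_Algebra.Formal_Power_Series" "HOL-Number_Theory.Residues"
begin

text \<open>An affine map \<open>u \<mapsto> ua + v\<close> has \<open>p\<close>-power order iff \<open>a\<close> is unipotent, and it is a derangement iff
  \<open>v\<close> lies outside the image of \<open>a - 1\<close>. So the proportion is the average over the unitary group of
  \<open>1 - q\<^sup>-\<^sup>2\<^sup>d\<close>, restricted to unipotent \<open>a\<close>, where \<open>d\<close> is the dimension of the fixed space. A Cayley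
  transform, available in every characteristic because it uses a scalar that is not fixed by conjugation,
  replaces the unipotent isometries by the nilpotent self-adjoint maps, without changing images.

  These are counted as in the Fine--Herstein theorem. The Fitting decomposition splits a
  self-adjoint map orthogonally into an invertible and a nilpotent one. Summing
  \<open>\<bar>range x\<bar>\<^sup>s\<close> over all self-adjoint \<open>x\<close> therefore gives a convolution of the unknown nilpotent sums with
  known numbers (Hermitian matrices of given rank, non-degenerate subspaces). With \<open>y = -1/q\<close>
  and \<open>t = y\<^sup>2\<^sup>s\<close> it becomes an identity of power series in which the nilpotent sums are found by
  division; the cases \<open>s = 0\<close> and \<open>s = 1\<close> give the formula.\<close>

section \<open>q-series\<close>

text \<open>The weight \<open>card (range x) ^ s\<close> is dictated by the target: a unipotent a
  contributes q^(2m) - |range (a - 1)| derangements, so exponents 0 and 1 suffice. This weight is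
  multiplicative along the Fitting decomposition, so each s gives a convolution of its own. The
  complement of a non-degenerate subspace is again non-degenerate, and only the invertible part on I
  = {0} leaves an unknown of full dimension. The equations are therefore triangular, and no
  classification of unipotent classes enters. The base y = -1/q appears because |U_k(q)| = q^(k*k)
  (y; y)_k, which up to sign is |GL_k(q)| with q replaced by -q. Numbers of subspaces over the field
  of order q^2 involve 1 - y^(2i) = (1 - y^i)(1 + y^i), the source of the products with plus signs.
  If x has corank d on a k-dimensional space, then |range x|^s = q^(2ks) t^d with t = y^(2s), so
  summing over all x evaluates the corank polynomial at t.\<close>

lemma q_pochhammer_0 [simp]: "q_pochhammer y 0 = 1"
  by (simp add: q_pochhammer_def)

lemma q_pochhammer_Suc: "q_pochhammer y (Suc k) = q_pochhammer y k * (1 - y ^ Suc k)"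
  by (simp add: q_pochhammer_def prod.nat_ivl_Suc' mult.commute)

text \<open>The q-shifted factorial (-y; y)_k. For y = -1/q, multiplying it by q^(k*k) gives the
  number of invertible Hermitian k x k matrices.\<close>

definition q_pochhammer_plus :: "real \<Rightarrow> nat \<Rightarrow> real" where
  "q_pochhammer_plus y k = (\<Prod>i=1..k. 1 + y ^ i)"

lemma q_pochhammer_plus_0 [simp]: "q_pochhammer_plus y 0 = 1"
  by (simp add: q_pochhammer_plus_def)

lemma q_pochhammer_plus_Suc:
  "q_pochhammer_plus y (Suc k) = q_pochhammer_plus y k * (1 + y ^ Suc k)"
  by (simp add: q_pochhammer_plus_def prod.nat_ivl_Suc' mult.commute)

text \<open>The general q-shifted factorial (t; y)_k, of which \<open>q_pochhammer\<close> is the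
  case t = y.\<close>

definition shifted_factorial :: "real \<Rightarrow> real \<Rightarrow> nat \<Rightarrow> real" where
  "shifted_factorial t y k = (\<Prod>l<k. 1 - t * y ^ l)"

lemma shifted_factorial_0 [simp]: "shifted_factorial t y 0 = 1"
  by (simp add: shifted_factorial_def)

lemma shifted_factorial_Suc:
  "shifted_factorial t y (Suc k) = (1 - t) * shifted_factorial (t * y) y k"
  unfolding shifted_factorial_def by (subst prod.lessThan_Suc_shift) (simp add: mult.assoc)

lemma shifted_factorial_one: "k > 0 \<Longrightarrow> shifted_factorial 1 y k = 0"
  by (cases k) (simp_all add: shifted_factorial_Suc)

text \<open>(y^2; y)_k is (y; y)_(k+1) without its first factor. This collapses the coefficients at
  s = 1, where t = y^2.\<close>

lemma shifted_factorial_square: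
  "(1 - y) * shifted_factorial (y ^ 2) y k = (1 - y ^ Suc k) * q_pochhammer y k"
proof -
  have "shifted_factorial (y ^ 2) y k * (1 - y) = q_pochhammer y (Suc k)"
  proof (induction k)
    case (Suc k)
    have "shifted_factorial (y ^ 2) y (Suc k) = shifted_factorial (y ^ 2) y k * (1 - y ^ Suc (Suc k))"
      by (simp add: shifted_factorial_def power2_eq_square mult.assoc)
    then show ?case using Suc.IH by (simp add: q_pochhammer_Suc mult_ac)
  qed (simp add: q_pochhammer_Suc)
  then show ?thesis
    by (simp add: q_pochhammer_Suc mult.commute)
qed

text \<open>For \<open>y = -1/q\<close>, the number of Hermitian \<open>k \<times> k\<close> matrices of corank \<open>d\<close> over the field of order
  \<open>q\<^sup>2\<close> is \<open>q ^ (k * k) * corank_weight y k d\<close>.\<close>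

definition corank_weight :: "real \<Rightarrow> nat \<Rightarrow> nat \<Rightarrow> real" where
  "corank_weight y k d = (if d \<le> k then (- y) ^ (d * d) *
     (q_pochhammer y k * q_pochhammer_plus y k) /
     (q_pochhammer y d * q_pochhammer_plus y d * q_pochhammer y (k - d)) else 0)"

text \<open>For y = -1/q, the average of t^corank over all Hermitian k x k matrices.\<close>

definition corank_sum :: "real \<Rightarrow> nat \<Rightarrow> real \<Rightarrow> real" where
  "corank_sum y k t = (\<Sum>d\<le>k. corank_weight y k d * t ^ d)"

text \<open>Coefficients of the factor that carries all dependence on t when the generating function
  of \<open>corank_sum y k t / q_pochhammer y k\<close> is factored, see
  \<open>corank_sum_eq\<close>.\<close>

definition fixed_coeff :: "real \<Rightarrow> real \<Rightarrow> nat \<Rightarrow> real" where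
  "fixed_coeff y t i = y ^ (i * (i + 1) div 2) * shifted_factorial t y i / q_pochhammer y i"

text \<open>For \<open>y = -1/q\<close> and \<open>t = y ^ (2 * s)\<close> this is the sum of \<open>\<bar>range x\<bar> ^ s\<close> over the nilpotent
  self-adjoint maps \<open>x\<close> of a \<open>k\<close>-dimensional Hermitian space, divided by \<open>q ^ (2 * k * s)\<close> and by the
  order of the unitary group.\<close>

definition nilpotent_sum :: "real \<Rightarrow> real \<Rightarrow> nat \<Rightarrow> real" where
  "nilpotent_sum y t k =
     (\<Sum>i\<le>k. fixed_coeff y t i * ((- y) ^ (k - i) / q_pochhammer y (k - i)))"

text \<open>The identities below are rational in y; these conditions keep the factors 1 - y^i and 1
  + y^i of the denominators away from 0.\<close>

locale q_base =
  fixes y :: real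
  assumes power_neq_one: "\<And>i. i > 0 \<Longrightarrow> y ^ i \<noteq> 1"
    and power_neq_minus_one: "\<And>i. i > 0 \<Longrightarrow> y ^ i \<noteq> -1"
begin

abbreviation "qp \<equiv> q_pochhammer y"
abbreviation "qpp \<equiv> q_pochhammer_plus y"

lemma factor_nz: "1 - y ^ Suc i \<noteq> 0" "1 + y ^ Suc i \<noteq> 0"
  using power_neq_one[of "Suc i"] power_neq_minus_one[of "Suc i"] by (auto simp: add_eq_0_iff)

lemma qp_nz: "qp k \<noteq> 0"
  by (induction k) (use factor_nz in \<open>auto simp: q_pochhammer_Suc\<close>)

lemma qpp_nz: "qpp k \<noteq> 0"
  by (induction k) (use factor_nz in \<open>auto simp: q_pochhammer_plus_Suc\<close>)

lemma corank_weight_0: "corank_weight y k 0 = qpp k"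
  using qp_nz by (simp add: corank_weight_def)

text \<open>A two-term Pascal rule in which d enters the coefficients only through y^d, so that for
  the corank polynomial it becomes the substitution t -> t*y.\<close>

lemma corank_weight_Suc:
  "corank_weight y (Suc k) (Suc d) =
     corank_weight y k (Suc d) * (1 + y ^ (k + d + 2)) - y ^ (k + d + 1) * corank_weight y k d"
proof (cases "d \<le> k")
  case True
  then obtain e where k: "k = d + e" by (auto simp: le_iff_add)
  \<comment> \<open>A is the common part of the three weights; without it a polynomial identity in
    y, y^d and y^e remains.\<close>
  define A where "A = (- y) ^ (d * d) * qp k * qpp k / (qp (Suc d) * qpp (Suc d) * qp e)"
  have R: "corank_weight y k d = A * ((1 - y ^ Suc d) * (1 + y ^ Suc d))"
    using factor_nz[of d] qp_nz qpp_nz unfolding A_def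
    by (simp add: corank_weight_def k q_pochhammer_Suc q_pochhammer_plus_Suc)
  have sq: "(- y) ^ (Suc d * Suc d) = (- y) ^ (d * d) * (- (y ^ (2 * d + 1)))"
  proof -
    have "(- y) ^ (Suc d * Suc d) = (- y) ^ (d * d) * (- y) ^ (2 * d + 1)"
      unfolding power_add[symmetric] by (rule arg_cong[where f = "\<lambda>i. (- y) ^ i"]) simp
    moreover have "(- y) ^ (2 * d + 1) = - (y ^ (2 * d + 1))" by (rule power_minus_odd) simp
    ultimately show ?thesis by (simp only:)
  qed
  have L: "corank_weight y (Suc k) (Suc d) =
      A * (- (y ^ (2 * d + 1))) * ((1 - y ^ Suc k) * (1 + y ^ Suc k))"
    unfolding A_def corank_weight_def sq using k
    by (simp add: q_pochhammer_Suc[of y "d + e"] q_pochhammer_plus_Suc[of y "d + e"] mult_ac)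
  have M: "corank_weight y k (Suc d) = A * (- (y ^ (2 * d + 1))) * (1 - y ^ e)"
  proof (cases e)
    case 0
    then show ?thesis by (simp add: k corank_weight_def)
  next
    case (Suc e')
    then show ?thesis
      using factor_nz[of e'] qp_nz qpp_nz unfolding A_def corank_weight_def sq k
      by (simp add: q_pochhammer_Suc[of y e'] mult_ac)
  qed
  show ?thesis
    unfolding L M R by (simp add: k algebra_simps power_add mult_2 mult_2_right)
next
  case False
  then show ?thesis by (simp add: corank_weight_def)
qed

lemma corank_weight_big: "d > k \<Longrightarrow> corank_weight y k d = 0"
  by (simp add: corank_weight_def)

lemma corank_sum_0: "corank_sum y 0 t = 1"
  using qp_nz qpp_nz by (simp add: corank_sum_def corank_weight_def)

lemma corank_sum_Suc:
  "corank_sum y (Suc k) t = corank_sum y k t + y ^ Suc k * (1 - t) * corank_sum y k (t * y)"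
proof -
  \<comment> \<open>Moves the index from d + 1 back to d. The term of index \<open>Suc k\<close>
    vanishes, and the missing term of index 0 is what \<open>corank_weight y (Suc k) 0\<close>
    supplies.\<close>
  have shift: "(\<Sum>d\<le>k. corank_weight y k (Suc d) * (1 + y ^ (k + d + 2)) * t ^ Suc d) =
      (\<Sum>d\<le>k. corank_weight y k d * (1 + y ^ (k + d + 1)) * t ^ d)
        - corank_weight y k 0 * (1 + y ^ Suc k)"
  proof -
    have "(\<Sum>d\<le>Suc k. corank_weight y k d * (1 + y ^ (k + d + 1)) * t ^ d) =
        corank_weight y k 0 * (1 + y ^ Suc k) +
        (\<Sum>d\<le>k. corank_weight y k (Suc d) * (1 + y ^ (k + d + 2)) * t ^ Suc d)"
      by (subst sum.atMost_Suc_shift) simp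
    then show ?thesis by (simp add: corank_weight_big)
  qed
  have "corank_sum y (Suc k) t = corank_weight y (Suc k) 0 +
      (\<Sum>d\<le>k. corank_weight y (Suc k) (Suc d) * t ^ Suc d)"
    unfolding corank_sum_def by (subst sum.atMost_Suc_shift) simp
  also have "\<dots> = corank_weight y k 0 * (1 + y ^ Suc k) +
      ((\<Sum>d\<le>k. corank_weight y k (Suc d) * (1 + y ^ (k + d + 2)) * t ^ Suc d) -
       (\<Sum>d\<le>k. y ^ (k + d + 1) * corank_weight y k d * t ^ Suc d))"
    unfolding corank_weight_Suc left_diff_distrib sum_subtractf
    by (simp add: corank_weight_0 q_pochhammer_plus_Suc)
  also have "\<dots> = (\<Sum>d\<le>k. corank_weight y k d * (1 + y ^ (k + d + 1)) * t ^ d) -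
       (\<Sum>d\<le>k. y ^ (k + d + 1) * corank_weight y k d * t ^ Suc d)"
    unfolding shift by simp
  also have "\<dots> = corank_sum y k t + y ^ Suc k * (1 - t) * corank_sum y k (t * y)"
    unfolding corank_sum_def sum_distrib_left sum_subtractf[symmetric] sum.distrib[symmetric]
    by (intro sum.cong) (simp_all add: algebra_simps power_add power_mult_distrib)
  finally show ?thesis .
qed

text \<open>Both sides satisfy the recursion \<open>corank_sum_Suc\<close>. It replaces t by t*y,
  hence the induction for arbitrary t; on the right the coefficient of index i + 1 at t is matched
  with the one of index i at t*y.\<close>

lemma corank_sum_eq:
  "corank_sum y k t = qp k * (\<Sum>i\<le>k. fixed_coeff y t i / qp (k - i))"
proof (induction k arbitrary: t)
  case 0
  then show ?case by (simp add: corank_sum_0 fixed_coeff_def)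
next
  case (Suc k)
  have exp: "y ^ (Suc i * (Suc i + 1) div 2) = y ^ (i * (i + 1) div 2) * y ^ Suc i" for i
  proof -
    have "Suc i * (Suc i + 1) div 2 = i * (i + 1) div 2 + Suc i" by simp
    then show ?thesis by (simp only: power_add)
  qed
  have coeff: "fixed_coeff y t (Suc i) * (1 - y ^ Suc i) = (1 - t) * y ^ Suc i * fixed_coeff y (t * y) i"
    for i using factor_nz[of i] qp_nz
    unfolding fixed_coeff_def exp shifted_factorial_Suc q_pochhammer_Suc by simp
  \<comment> \<open>the factor \<open>1 - y ^ Suc k\<close> is split to get the \<open>q\<close>-Pascal rule\<close>
  have split: "(1 - y ^ Suc k) * (fixed_coeff y t i / qp (Suc k - i)) =
      (if i \<le> k then fixed_coeff y t i / qp (k - i) else 0) +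
      y ^ (Suc k - i) * (1 - y ^ i) * (fixed_coeff y t i / qp (Suc k - i))"
    if "i \<le> Suc k" for i
  proof -
    have "(1 - y ^ (Suc k - i)) * (fixed_coeff y t i / qp (Suc k - i)) =
        (if i \<le> k then fixed_coeff y t i / qp (k - i) else 0)"
      using qp_nz factor_nz[of "k - i"] that
      by (cases "i = Suc k") (simp_all add: Suc_diff_le q_pochhammer_Suc)
    moreover have "1 - y ^ Suc k = (1 - y ^ (Suc k - i)) + y ^ (Suc k - i) * (1 - y ^ i)"
      using that by (simp add: algebra_simps flip: power_add)
    ultimately show ?thesis by (simp only: distrib_right)
  qed
  have "qp (Suc k) * (\<Sum>i\<le>Suc k. fixed_coeff y t i / qp (Suc k - i)) =
      qp k * (\<Sum>i\<le>Suc k. (1 - y ^ Suc k) * (fixed_coeff y t i / qp (Suc k - i)))"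
    by (simp only: q_pochhammer_Suc sum_distrib_left mult.assoc)
  also have "(\<Sum>i\<le>Suc k. (1 - y ^ Suc k) * (fixed_coeff y t i / qp (Suc k - i))) =
      (\<Sum>i\<le>Suc k. if i \<le> k then fixed_coeff y t i / qp (k - i) else 0) +
      (\<Sum>i\<le>Suc k. y ^ (Suc k - i) * (1 - y ^ i) * (fixed_coeff y t i / qp (Suc k - i)))"
    unfolding sum.distrib[symmetric] by (intro sum.cong refl split) auto
  also have "(\<Sum>i\<le>Suc k. if i \<le> k then fixed_coeff y t i / qp (k - i) else 0) =
      (\<Sum>i\<le>k. fixed_coeff y t i / qp (k - i))"
    by simp
  also have "(\<Sum>i\<le>Suc k. y ^ (Suc k - i) * (1 - y ^ i) * (fixed_coeff y t i / qp (Suc k - i))) =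
      (\<Sum>i\<le>k. y ^ (k - i) * (fixed_coeff y t (Suc i) * (1 - y ^ Suc i)) / qp (k - i))"
    by (subst sum.atMost_Suc_shift) (simp add: mult_ac)
  also have "\<dots> = (\<Sum>i\<le>k. y ^ Suc k * (1 - t) * (fixed_coeff y (t * y) i / qp (k - i)))"
    unfolding coeff
  proof (intro sum.cong refl)
    fix i assume "i \<in> {..k}"
    then have "y ^ Suc k = y ^ (k - i) * y ^ Suc i" by (simp flip: power_add power_Suc)
    then show "y ^ (k - i) * ((1 - t) * y ^ Suc i * fixed_coeff y (t * y) i) / qp (k - i) =
        y ^ Suc k * (1 - t) * (fixed_coeff y (t * y) i / qp (k - i))"
      by (simp only:) simp
  qed
  also have "\<dots> = y ^ Suc k * (1 - t) * (\<Sum>i\<le>k. fixed_coeff y (t * y) i / qp (k - i))"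
    by (simp only: sum_distrib_left)
  finally show ?case
    unfolding corank_sum_Suc Suc.IH by (simp only: algebra_simps)
qed

text \<open>For |y| < 1 the q-binomial theorem gives the factors as the products over l >= 0 of 1/(1
  + u y^(l+1)) and (1 + u y^(l+1))/(1 - u y^l), so the plus signs cancel. The proof replaces the
  infinite products by the recursions of the coefficients, splitting 1 - y^(k+1) between the two
  factors.\<close>

lemma convolution_inverse:
  "(\<Sum>j\<le>k. (- y) ^ j / qp j * (qpp (k - j) / qp (k - j))) = 1 / qp k"
proof (induction k)
  case 0
  then show ?case by simp
next
  case (Suc k)
  define n where "n j = (- y) ^ j / qp j" for j
  define G where "G j = qpp j / qp j" for j
  have n: "(1 - y ^ Suc j) * n (Suc j) = - y * n j" for j
    using factor_nz[of j] qp_nz by (simp add: n_def q_pochhammer_Suc)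
  have G: "(1 - y ^ Suc j) * G (Suc j) = (1 + y ^ Suc j) * G j" for j
    using factor_nz[of j] qp_nz by (simp add: G_def q_pochhammer_Suc q_pochhammer_plus_Suc)
  have "(1 - y ^ Suc k) * (\<Sum>j\<le>Suc k. n j * G (Suc k - j)) =
      (\<Sum>j\<le>Suc k. n j * ((1 - y ^ (Suc k - j)) * G (Suc k - j))) +
      (\<Sum>j\<le>Suc k. y ^ (Suc k - j) * ((1 - y ^ j) * n j) * G (Suc k - j))"
    unfolding sum_distrib_left sum.distrib[symmetric]
  proof (intro sum.cong refl)
    fix j assume "j \<in> {..Suc k}"
    then have "y ^ Suc k = y ^ (Suc k - j) * y ^ j" by (simp flip: power_add)
    then show "(1 - y ^ Suc k) * (n j * G (Suc k - j)) =
        n j * ((1 - y ^ (Suc k - j)) * G (Suc k - j)) +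
        y ^ (Suc k - j) * ((1 - y ^ j) * n j) * G (Suc k - j)"
      by (simp only:) (simp only: algebra_simps)
  qed
  also have "(\<Sum>j\<le>Suc k. n j * ((1 - y ^ (Suc k - j)) * G (Suc k - j))) =
      (\<Sum>j\<le>k. n j * ((1 + y ^ Suc (k - j)) * G (k - j)))"
  proof -
    have "(\<Sum>j\<le>k. n j * ((1 - y ^ (Suc k - j)) * G (Suc k - j))) =
        (\<Sum>j\<le>k. n j * ((1 + y ^ Suc (k - j)) * G (k - j)))"
      by (intro sum.cong refl) (simp only: atMost_iff Suc_diff_le G)
    then show ?thesis by (simp only: sum.atMost_Suc) simp
  qed
  also have "(\<Sum>j\<le>Suc k. y ^ (Suc k - j) * ((1 - y ^ j) * n j) * G (Suc k - j)) =
      (\<Sum>j\<le>k. y ^ (k - j) * (- y * n j) * G (k - j))"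
    by (simp only: sum.atMost_Suc_shift n) simp
  also have "(\<Sum>j\<le>k. n j * ((1 + y ^ Suc (k - j)) * G (k - j))) + \<dots> =
      (\<Sum>j\<le>k. n j * G (k - j))"
    unfolding sum.distrib[symmetric] by (intro sum.cong refl) (simp add: algebra_simps)
  also have "\<dots> = 1 / qp k" using Suc.IH unfolding n_def G_def .
  finally have "(1 - y ^ Suc k) * (\<Sum>j\<le>Suc k. n j * G (Suc k - j)) = 1 / qp k" .
  then have "(\<Sum>j\<le>Suc k. n j * G (Suc k - j)) = 1 / qp k / (1 - y ^ Suc k)"
    using factor_nz(1)[of k] by (metis nonzero_mult_div_cancel_left)
  then show ?case
    unfolding n_def G_def by (simp only: q_pochhammer_Suc divide_divide_eq_left)
qed

text \<open>\<open>nilpotent_sum\<close> consists of the coefficients of X * N. As N * G = E by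
  \<open>convolution_inverse\<close>, multiplying by G gives X * E, the series of
  \<open>corank_sum_eq\<close>.\<close>

lemma nilpotent_sum_convolution:
  "(\<Sum>j\<le>k. qpp j / qp j * nilpotent_sum y t (k - j)) = corank_sum y k t / qp k"
proof -
  define X where "X = Abs_fps (fixed_coeff y t)"
  define N where "N = Abs_fps (\<lambda>j. (- y) ^ j / qp j)"
  define G where "G = Abs_fps (\<lambda>j. qpp j / qp j)"
  define E where "E = Abs_fps (\<lambda>j. 1 / qp j)"
  have "N * G = E"
    unfolding N_def G_def E_def
    by (rule fps_ext) (simp only: fps_mult_nth fps_nth_Abs_fps atLeast0AtMost convolution_inverse)
  then have "G * (X * N) = X * E" by (metis mult.left_commute mult.commute)
  then have "fps_nth (G * (X * N)) k = fps_nth (X * E) k" by (simp only:)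
  then show ?thesis
    using qp_nz by (simp add: fps_mult_nth G_def N_def X_def E_def atLeast0AtMost
      nilpotent_sum_def corank_sum_eq)
qed

text \<open>Every Hermitian matrix has some corank, so the weights add up to 1. This normalisation
  drives \<open>card_self_adjoint_onto\<close>.\<close>

lemma corank_sum_one: "corank_sum y k 1 = 1"
  using qp_nz by (induction k) (simp_all add: corank_sum_0 corank_sum_Suc)

end

text \<open>At t = 1 only the term i = 0 survives. For y = -1/q, multiplying by |U_k(q)| gives
  q^(k*k - k), Steinberg's number of unipotent elements of U_k(q).\<close>

lemma nilpotent_sum_one: "nilpotent_sum y 1 k = (- y) ^ k / q_pochhammer y k"
proof -
  have "nilpotent_sum y 1 k = (\<Sum>i\<in>{0}. fixed_coeff y 1 i * ((- y) ^ (k - i) / q_pochhammer y (k - i)))"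
    unfolding nilpotent_sum_def
    by (intro sum.mono_neutral_right) (auto simp: fixed_coeff_def shifted_factorial_one)
  then show ?thesis by (simp add: fixed_coeff_def)
qed

lemma (in q_base) nilpotent_sum_square:
  "nilpotent_sum y (y ^ 2) k = (\<Sum>i\<le>k. y ^ (i * (i + 1) div 2) * (1 - y ^ Suc i) / (1 - y) *
     ((- y) ^ (k - i) / qp (k - i)))"
proof -
  have "1 - y \<noteq> 0" using factor_nz[of 0] by simp
  then have "fixed_coeff y (y ^ 2) i = y ^ (i * (i + 1) div 2) * (1 - y ^ Suc i) / (1 - y)" for i
    using shifted_factorial_square[of y i] qp_nz[of i]
    by (simp add: fixed_coeff_def divide_simps mult_ac)
  then show ?thesis by (simp add: nilpotent_sum_def)
qed

lemma q_base_neg_inverse: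
  assumes "q \<ge> 2"
  shows "q_base (- 1 / real q)"
proof
  fix i :: nat assume "i > 0"
  have "\<bar>- 1 / real q\<bar> < 1" using assms by simp
  then have "\<bar>- 1 / real q\<bar> ^ i < 1"
    using \<open>i > 0\<close> by (subst power_less_one_iff) auto
  then have "\<bar>(- 1 / real q) ^ i\<bar> < 1" by (simp only: power_abs)
  then show "(- 1 / real q) ^ i \<noteq> 1" "(- 1 / real q) ^ i \<noteq> - 1" by linarith+
qed

text \<open>The term i = 0 at t = y^2 equals the whole sum at t = 1, which is why the sum in the
  theorem starts at 1.\<close>

lemma nilpotent_sum_difference:
  fixes q m :: nat
  assumes q: "q \<ge> 2"
  defines "y \<equiv> - 1 / real q"
  shows "nilpotent_sum y 1 m - nilpotent_sum y (y ^ 2) m =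
     1 / (real q ^ m * (real q + 1)) *
       (\<Sum>i=1..m. (-1) ^ i * ((- real q) ^ (i + 1) - 1)
         / ((- real q) ^ (i * (i + 1) div 2) * q_pochhammer y (m - i)))"
proof -
  interpret q_base y unfolding y_def by (rule q_base_neg_inverse) (rule q)
  define f where "f i = y ^ (i * (i + 1) div 2) * (1 - y ^ Suc i) / (1 - y) *
     ((- y) ^ (m - i) / qp (m - i))" for i
  have "nilpotent_sum y (y ^ 2) m = (\<Sum>i\<in>insert 0 {1..m}. f i)"
    unfolding nilpotent_sum_square f_def by (intro sum.cong) auto
  also have "\<dots> = nilpotent_sum y 1 m + (\<Sum>i=1..m. f i)"
    using factor_nz[of 0] by (simp add: f_def nilpotent_sum_one)
  finally have "nilpotent_sum y 1 m - nilpotent_sum y (y ^ 2) m = (\<Sum>i=1..m. - f i)"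
    by (simp add: sum_negf)
  also have "\<dots> = (\<Sum>i=1..m. 1 / (real q ^ m * (real q + 1)) * ((-1) ^ i * ((- real q) ^ (i + 1) - 1)
         / ((- real q) ^ (i * (i + 1) div 2) * q_pochhammer y (m - i))))"
  proof (intro sum.cong refl)
    fix i assume "i \<in> {1..m}"
    then have i: "i \<le> m" by simp
    have q0: "real q \<noteq> 0" "real q + 1 \<noteq> 0" using q by auto
    have "y = 1 / (- real q)" by (simp add: y_def)
    then have yinv: "y ^ j = 1 / (- real q) ^ j" for j by (simp only: power_one_over)
    have 1: "(- y) ^ (m - i) = real q ^ i / real q ^ m"
      using i q0 by (simp add: y_def power_divide power_diff)
    have 2: "1 - y = (real q + 1) / real q" using q0 by (simp add: y_def field_simps)
    have 3: "1 - y ^ Suc i = ((- real q) ^ (i + 1) - 1) / (- real q) ^ (i + 1)"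
      unfolding yinv using q0 by (simp add: diff_divide_distrib)
    have 4: "(- real q) ^ (i + 1) = - ((-1) ^ i * real q ^ i * real q)"
      by (simp add: power_minus[of "real q"])
    have 5: "((-1::real) ^ i) * (-1) ^ i = 1" by (simp flip: power_mult_distrib)
    \<comment> \<open>The powers become atoms: s = (-1)^i, w = q^i, R = (-q)^(i+1). In the
      denominator R is expanded as -(s * w * qq) so that w cancels.\<close>
    have gen: "- (1 / D * ((R - 1) / (- (s * w * qq))) / ((qq + 1) / qq) * (w / M / P)) =
        1 / (M * (qq + 1)) * (s * (R - 1) / (D * P))"
      if "s * s = 1" "w \<noteq> 0" "qq \<noteq> 0" "qq + 1 \<noteq> 0" for s w qq D R M P :: real
    proof -
      have "s \<noteq> 0" using that by auto
      then have "1 / s = s" using that by (simp add: field_simps)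
      then show ?thesis using that \<open>s \<noteq> 0\<close> by (auto simp: divide_simps) 
    qed
    show "- f i = 1 / (real q ^ m * (real q + 1)) * ((-1) ^ i * ((- real q) ^ (i + 1) - 1)
         / ((- real q) ^ (i * (i + 1) div 2) * q_pochhammer y (m - i)))"
      unfolding f_def 1 2 3 yinv[of "i * (i + 1) div 2"]
      \<comment> \<open>Only the copy of (-q)^(i+1) in the denominator is expanded; the one in the
        numerator occurs in the claim.\<close>
      by (subst (2) 4, rule gen) (use q0 5 in auto)
  qed
  finally show ?thesis by (simp add: sum_distrib_left)
qed

section \<open>Counting subspaces over a finite field\<close>

text \<open>The shape covers the three polynomials needed later: X^q - X, X^q + X and X^(q+1) -
  c.\<close>

lemma card_roots_le:
  fixes b c :: "'a::field"
  assumes "n \<ge> 2"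
  shows "card {x. x ^ n + b * x + c = 0} \<le> n"
proof -
  define P where "P = Polynomial.monom (1::'a) n + [:c, b:]"
  have P: "degree P = n" unfolding P_def
    by (subst degree_add_eq_left) (use assms in \<open>auto simp: Polynomial.degree_monom_eq\<close>)
  then have "P \<noteq> 0" using assms by auto
  moreover have "{x. x ^ n + b * x + c = 0} = {x. poly P x = 0}"
    by (auto simp: P_def poly_monom algebra_simps)
  ultimately show ?thesis using card_poly_roots_bound[of P] P by simp
qed

text \<open>Multiplication by a nonzero x permutes the nonzero elements; comparing their products
  gives x^(|F| - 1) = 1.\<close>

lemma finite_field_power_card:
  fixes x :: "'a::{field,finite}"
  shows "x ^ CARD('a) = x"
proof (cases "x = 0")
  case False
  let ?U = "UNIV - {0::'a}"
  have "(\<Prod>z\<in>?U. x * z) = (\<Prod>z\<in>?U. z)"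
    by (rule prod.reindex_bij_witness[where i = "\<lambda>z. z / x" and j = "\<lambda>z. x * z"]) (use False in auto)
  then have "x ^ card ?U * (\<Prod>z\<in>?U. z) = (\<Prod>z\<in>?U. z)"
    by (simp add: prod.distrib)
  moreover have "(\<Prod>z\<in>?U. z) \<noteq> 0" by simp
  ultimately have "x ^ card ?U = 1" by simp
  moreover have "CARD('a) = Suc (card ?U)"
    by (simp add: card_gt_0_iff)
  ultimately show ?thesis by (metis power_Suc mult.right_neutral)
next
  case True
  then show ?thesis by (simp add: power_0_left)
qed

lemma card_span_insert:
  fixes S :: "('a::{field,finite}^'n) set"
  assumes "x \<notin> vec.span S"
  shows "card (vec.span (insert x S)) = CARD('a) * card (vec.span S)"
proof -
  have "bij_betw (\<lambda>(c, u). c *s x + u) (UNIV \<times> vec.span S) (vec.span (insert x S))"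
  proof (rule bij_betwI')
    fix a b :: "'a \<times> ('a^'n)"
    assume ab: "a \<in> UNIV \<times> vec.span S" "b \<in> UNIV \<times> vec.span S"
    obtain c u d v where [simp]: "a = (c, u)" "b = (d, v)" by (cases a, cases b)
    have "c = d" if "c *s x + u = d *s x + v"
    proof (rule ccontr)
      assume "c \<noteq> d"
      have "(c - d) *s x = v - u" using that by (simp add: algebra_simps vec.scale_left_diff_distrib)
      then have "(c - d) *s x \<in> vec.span S" using ab by (auto intro: vec.span_diff)
      then have "inverse (c - d) *s ((c - d) *s x) \<in> vec.span S" by (rule vec.span_scale)
      moreover have "inverse (c - d) *s ((c - d) *s x) = x"
        using \<open>c \<noteq> d\<close> by (simp only: vec.scale_scale left_inverse right_minus_eq not_False_eq_True vec.scale_one)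
      ultimately show False using assms by simp
    qed
    then show "((case a of (c, u) \<Rightarrow> c *s x + u) = (case b of (c, u) \<Rightarrow> c *s x + u)) = (a = b)"
      by auto
  next
    fix a :: "'a \<times> ('a^'n)" assume "a \<in> UNIV \<times> vec.span S"
    then show "(case a of (c, u) \<Rightarrow> c *s x + u) \<in> vec.span (insert x S)"
      using vec.span_mono[of S "insert x S"]
      by (auto intro!: vec.span_add vec.span_scale vec.span_base[of x])
  next
    fix w assume "w \<in> vec.span (insert x S)"
    then obtain k where "w - k *s x \<in> vec.span S" by (auto simp: vec.span_insert)
    then show "\<exists>a\<in>UNIV \<times> vec.span S. w = (case a of (c, u) \<Rightarrow> c *s x + u)"
      by (intro bexI[of _ "(k, w - k *s x)"]) auto
  qed
  from bij_betw_same_card[OF this] show ?thesis by (simp add: card_cartesian_product)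
qed

text \<open>Ordered tuples instead of sets, built from the tail, so that they can be counted one
  vector at a time.\<close>

fun indep_list :: "('a::field^'n) list \<Rightarrow> bool" where
  "indep_list [] \<longleftrightarrow> True"
| "indep_list (x # xs) \<longleftrightarrow> x \<notin> vec.span (set xs) \<and> indep_list xs"

lemma card_span_indep_list:
  fixes xs :: "('a::{field,finite}^'n) list"
  shows "indep_list xs \<Longrightarrow> card (vec.span (set xs)) = CARD('a) ^ length xs"
  by (induction xs) (auto simp: card_span_insert)

lemma subspace_obtains_indep_list:
  assumes "vec.subspace (W :: ('a::{field,finite}^'n) set)"
  obtains xs where "indep_list xs" "vec.span (set xs) = W" "length xs = vec.dim W"
proof -
  obtain S where S: "S \<subseteq> W" "vec.independent S" "W \<subseteq> vec.span S" "card S = vec.dim W"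
    by (rule vec.basis_exists)
  have "\<exists>xs. indep_list xs \<and> set xs = T \<and> length xs = card T" if "vec.independent T" for T :: "('a^'n) set"
    using finite[of T] that
  proof (induction T rule: finite_induct)
    case (insert x T)
    then have x: "x \<notin> vec.span T" "vec.independent T"
      by (auto simp: vec.independent_insert)
    then obtain xs where "indep_list xs" "set xs = T" "length xs = card T"
      using insert.IH by blast
    then show ?case using x insert.hyps by (intro exI[of _ "x # xs"]) auto
  qed (auto intro: exI[of _ "[]"])
  then obtain xs where "indep_list xs" "set xs = S" "length xs = card S" using S(2) by blast
  moreover have "vec.span S = W"
    using S assms by (intro antisym) (auto intro: vec.span_minimal[THEN subsetD])
  ultimately show ?thesis using that S(4) by metis
qed

lemma card_subspace:
  assumes "vec.subspace (W :: ('a::{field,finite}^'n) set)"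
  shows "card W = CARD('a) ^ vec.dim W"
  using subspace_obtains_indep_list[OF assms] card_span_indep_list by metis

lemma card_field_gt_one: "CARD('a::{field,finite}) > 1"
  using card_mono[of UNIV "{0::'a, 1}"] by simp

lemma dim_eq_iff_card:
  assumes "vec.subspace (W :: ('a::{field,finite}^'n) set)"
  shows "vec.dim W = k \<longleftrightarrow> card W = CARD('a) ^ k"
  using card_subspace[OF assms] card_field_gt_one[where 'a='a] by simp

lemma dim_span_indep_list:
  fixes xs :: "('a::{field,finite}^'n) list"
  shows "indep_list xs \<Longrightarrow> vec.dim (vec.span (set xs)) = length xs"
  by (subst dim_eq_iff_card) (auto simp: card_span_indep_list)

lemma subspace_eqI:
  assumes "vec.subspace (U :: ('a::{field,finite}^'n) set)" "vec.subspace W" "U \<subseteq> W"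
    "vec.dim U = vec.dim W"
  shows "U = W"
  using assms by (intro card_subset_eq) (auto simp: card_subspace)

lemma dim_subspace_less:
  assumes "vec.subspace (U :: ('a::{field,finite}^'n) set)" "vec.subspace W" "U \<subset> W"
  shows "vec.dim U < vec.dim W"
proof -
  have "card U < card W" using assms(3) by (intro psubset_card_mono) auto
  then show ?thesis
    using assms card_field_gt_one[where 'a='a] by (simp add: card_subspace)
qed

lemma dim_subspace_UNIV: "vec.dim (UNIV :: ('a::{field,finite}^'n) set) = CARD('n)"
  by (subst dim_eq_iff_card) auto

section \<open>Gaussian binomial coefficients from counting ordered bases\<close>

definition grassmannian :: "('a::field^'n) set \<Rightarrow> nat \<Rightarrow> ('a^'n) set set" where
  "grassmannian W r = {J. vec.subspace J \<and> J \<subseteq> W \<and> vec.dim J = r}"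

lemma card_indep_lists:
  fixes W :: "('a::{field,finite}^'n) set"
  assumes W: "vec.subspace W"
  shows "real (card {xs. indep_list xs \<and> set xs \<subseteq> W \<and> length xs = r}) =
    (\<Prod>l<r. real CARD('a) ^ vec.dim W - real CARD('a) ^ l)"
proof (induction r)
  case 0
  have "{xs. indep_list xs \<and> set xs \<subseteq> W \<and> length xs = 0} = {[]}" by auto
  then show ?case by simp
next
  case (Suc r)
  let ?L = "\<lambda>r. {xs. indep_list xs \<and> set xs \<subseteq> W \<and> length xs = r}"
  have fin: "finite (?L r)" for r
    by (rule finite_subset[OF _ finite_lists_length_eq[of W r]]) auto
  have "?L (Suc r) = (\<lambda>(xs, x). x # xs) ` (SIGMA xs:?L r. W - vec.span (set xs))"
    by (auto simp: length_Suc_conv image_iff)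
  moreover have "inj_on (\<lambda>(xs, x). x # xs) (SIGMA xs:?L r. W - vec.span (set xs))"
    by (auto simp: inj_on_def)
  ultimately have "card (?L (Suc r)) = card (SIGMA xs:?L r. W - vec.span (set xs))"
    by (simp only: card_image)
  also have "\<dots> = (\<Sum>xs\<in>?L r. card (W - vec.span (set xs)))"
    using fin by (subst card_SigmaI) auto
  finally have "real (card (?L (Suc r))) = (\<Sum>xs\<in>?L r. real (card (W - vec.span (set xs))))"
    by simp
  also have "\<dots> = (\<Sum>xs\<in>?L r. real CARD('a) ^ vec.dim W - real CARD('a) ^ r)"
  proof (intro sum.cong refl)
    fix xs assume xs: "xs \<in> ?L r"
    then have sub: "vec.span (set xs) \<subseteq> W" using W by (auto intro: vec.span_minimal[THEN subsetD])
    have "card (W - vec.span (set xs)) = card W - card (vec.span (set xs))"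
      using sub by (intro card_Diff_subset) auto
    moreover have "card (vec.span (set xs)) \<le> card W" using sub by (intro card_mono) auto
    ultimately show "real (card (W - vec.span (set xs))) = real CARD('a) ^ vec.dim W - real CARD('a) ^ r"
      using xs card_span_indep_list[of xs] W by (simp add: of_nat_diff card_subspace)
  qed
  finally show ?case using Suc.IH by simp
qed

text \<open>Independent lists of length r in W are sorted by their span. In product form the
  identity also covers r > dim W, where the right side contains the factor 0.\<close>

lemma card_grassmannian:
  fixes W :: "('a::{field,finite}^'n) set"
  assumes W: "vec.subspace W"
  defines "Q \<equiv> real CARD('a)"
  shows "real (card (grassmannian W r)) * (\<Prod>l<r. Q ^ r - Q ^ l) = (\<Prod>l<r. Q ^ vec.dim W - Q ^ l)"
proof -
  let ?L = "\<lambda>W. {xs. indep_list xs \<and> set xs \<subseteq> W \<and> length xs = r}"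
  have fin: "finite (?L W)" for W :: "('a^'n) set"
    by (rule finite_subset[OF _ finite_lists_length_eq[of W r]]) auto
  have span: "vec.span (set xs) = J" if "J \<in> grassmannian W r" "xs \<in> ?L J" for J xs
    using that dim_span_indep_list[of xs]
    by (intro subspace_eqI) (auto simp: grassmannian_def intro: vec.span_minimal[THEN subsetD])
  have "?L W = (\<Union>J\<in>grassmannian W r. ?L J)"
  proof (intro equalityI subsetI)
    fix xs assume xs: "xs \<in> ?L W"
    then have "vec.span (set xs) \<in> grassmannian W r"
      using W dim_span_indep_list[of xs]
      by (auto simp: grassmannian_def intro: vec.span_minimal[THEN subsetD])
    then show "xs \<in> (\<Union>J\<in>grassmannian W r. ?L J)"
      using xs by (auto intro!: bexI[of _ "vec.span (set xs)"] vec.span_base)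
  qed (auto simp: grassmannian_def)
  then have "card (?L W) = (\<Sum>J\<in>grassmannian W r. card (?L J))"
  proof (simp only:, intro card_UN_disjoint ballI impI)
    fix I J assume IJ: "I \<in> grassmannian W r" "J \<in> grassmannian W r" "I \<noteq> J"
    show "?L I \<inter> ?L J = {}" using span[OF IJ(1)] span[OF IJ(2)] IJ(3) by blast
  qed (use fin in auto)
  then have "real (card (?L W)) = (\<Sum>J\<in>grassmannian W r. real (card (?L J)))" by simp
  also have "\<dots> = (\<Sum>J\<in>grassmannian W r. \<Prod>l<r. Q ^ r - Q ^ l)"
    by (intro sum.cong refl) (auto simp: card_indep_lists grassmannian_def Q_def)
  finally show ?thesis using card_indep_lists[OF W, of r] by (simp add: Q_def)
qed

lemma sum_over_subspaces:
  fixes W :: "('a::{field,finite}^'n) set" and f :: "nat \<Rightarrow> real"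
  assumes W: "vec.subspace W"
  shows "(\<Sum>J | vec.subspace J \<and> J \<subseteq> W. f (vec.dim J)) =
    (\<Sum>r\<le>vec.dim W. real (card (grassmannian W r)) * f r)"
proof -
  have "(\<Sum>J | vec.subspace J \<and> J \<subseteq> W. f (vec.dim J)) =
    (\<Sum>r\<le>vec.dim W. \<Sum>J | J \<in> {J. vec.subspace J \<and> J \<subseteq> W} \<and> vec.dim J = r. f (vec.dim J))"
    by (rule sum.group[symmetric]) (auto intro: vec.dim_subset)
  also have "\<dots> = (\<Sum>r\<le>vec.dim W. \<Sum>J\<in>grassmannian W r. f r)"
    by (intro sum.cong) (auto simp: grassmannian_def)
  finally show ?thesis by simp
qed

section \<open>Hermitian spaces\<close>

text \<open>Equals q^(k(k-1)/2) times the product of q^i - (-1)^i over i = 1..k, the order of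
  U_k(q); \<open>card_isometries\<close> proves this for k = m.\<close>

definition unitary_order :: "nat \<Rightarrow> nat \<Rightarrow> real" where
  "unitary_order q k = real q ^ (k * k) * q_pochhammer (- 1 / real q) k"

locale hermitian_space =
  fixes p q :: nat and B :: "('a::{field,finite})^'n \<Rightarrow> 'a^'n \<Rightarrow> 'a"
  assumes prime_p: "prime p" and q_power: "\<exists>k\<ge>1. q = p ^ k"
    and card_field: "CARD('a) = q ^ 2"
    and hermitian: "hermitian_form q B" and nondegenerate: "nondegenerate B"
begin

lemma q_ge_2: "q \<ge> 2"
proof -
  obtain k where k: "k \<ge> 1" "q = p ^ k" using q_power by blast
  have "p ^ 1 \<le> p ^ k" using k prime_gt_0_nat[OF prime_p] by (intro power_increasing) auto
  then show ?thesis using k prime_ge_2_nat[OF prime_p] by simp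
qed

sublocale q_base "- 1 / real q"
  by (rule q_base_neg_inverse) (rule q_ge_2)

section \<open>Conjugation, trace and norm over the subfield of order q\<close>

lemma CHAR_eq: "CHAR('a) = p"
proof -
  obtain k where k: "q = p ^ k" using q_power by blast
  have "prime CHAR('a)"
    by (rule prime_CHAR_semidom) (rule finite_imp_CHAR_pos, simp)
  moreover have "CHAR('a) dvd p ^ (k * 2)"
    using CHAR_dvd_CARD[where 'a='a] card_field k by (simp add: power_mult)
  ultimately have "CHAR('a) dvd p" using prime_dvd_power by blast
  with \<open>prime CHAR('a)\<close> show ?thesis using prime_p primes_dvd_imp_eq by blast
qed

lemma conj_add: "((a::'a) + b) ^ q = a ^ q + b ^ q"
proof -
  obtain k where k: "q = p ^ k" using q_power by blast
  show ?thesis using freshmans_dream'[of q k a b] CHAR_eq prime_p k by simp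
qed

lemma conj_zero [simp]: "(0::'a) ^ q = 0"
  using q_ge_2 by simp

lemma conj_minus: "(- (a::'a)) ^ q = - (a ^ q)"
  using conj_add[of a "- a"] by (simp add: eq_neg_iff_add_eq_0 add.commute)

lemma conj_diff: "((a::'a) - b) ^ q = a ^ q - b ^ q"
  using conj_add[of a "- b"] by (simp add: conj_minus)

lemma conj_conj [simp]: "((a::'a) ^ q) ^ q = a"
  using finite_field_power_card[of a] by (simp add: card_field power2_eq_square power_mult)

lemma conj_eq_0_iff [simp]: "(a::'a) ^ q = 0 \<longleftrightarrow> a = 0"
  using q_ge_2 by simp

definition fixed_field :: "'a set" where
  "fixed_field = {c. c ^ q = c}"

lemma norm_in_fixed_field: "(x::'a) ^ Suc q \<in> fixed_field"
  by (simp add: fixed_field_def power_mult_distrib mult.commute)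

text \<open>A squeeze proves both claims at once: at most q - 1 norm fibres, each of size at most q
  + 1, cover the (q - 1)(q + 1) nonzero elements, so every bound is attained.\<close>

lemma card_fixed_field_and_norm_fibre:
  "card fixed_field = q \<and> (\<forall>c\<in>fixed_field - {0}. card {x::'a. x ^ Suc q = c} = Suc q)"
proof -
  have le1: "card fixed_field \<le> q"
    using card_roots_le[of q "-1::'a" 0] q_ge_2 by (simp add: fixed_field_def)
  have le2: "card {x::'a. x ^ Suc q = c} \<le> Suc q" for c
    using card_roots_le[of "Suc q" "0::'a" "- c"] q_ge_2 by simp
  have z: "0 \<in> fixed_field" by (simp add: fixed_field_def)
  let ?C = "fixed_field - {0}"
  have cC: "card ?C \<le> q - 1" using le1 z by (simp add: card_Diff_singleton_if)
  have "UNIV - {0::'a} = (\<Union>c\<in>?C. {x. x ^ Suc q = c})"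
    using norm_in_fixed_field by auto
  then have "card (UNIV - {0::'a}) = (\<Sum>c\<in>?C. card {x::'a. x ^ Suc q = c})"
    by (simp only:) (intro card_UN_disjoint, auto)
  moreover have "card (UNIV - {0::'a}) = (q - 1) * Suc q"
  proof -
    have "card (UNIV - {0::'a}) = q * q - 1" by (simp add: card_field power2_eq_square card_Diff_singleton_if)
    also have "\<dots> = (q - 1) * Suc q" using q_ge_2 by (cases q) simp_all
    finally show ?thesis .
  qed
  ultimately have sum: "(\<Sum>c\<in>?C. card {x::'a. x ^ Suc q = c}) = (q - 1) * Suc q" by simp
  have "(q - 1) * Suc q \<le> card ?C * Suc q"
    unfolding sum[symmetric] using sum_mono[of ?C "\<lambda>c. card {x::'a. x ^ Suc q = c}" "\<lambda>_. Suc q"] le2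
    by (simp del: power_Suc)
  then have "q - 1 \<le> card ?C" by (metis Suc_mult_le_cancel1 mult.commute)
  with cC have C: "card ?C = q - 1" by simp
  then have "card fixed_field = q"
    using z q_ge_2 le1 by (simp add: card_Diff_singleton_if)
  moreover have "card {x::'a. x ^ Suc q = c} = Suc q" if c: "c \<in> ?C" for c
  proof (rule ccontr)
    assume "card {x::'a. x ^ Suc q = c} \<noteq> Suc q"
    then have "card {x::'a. x ^ Suc q = c} < Suc q" using le2[of c] by simp
    then have "(\<Sum>c\<in>?C. card {x::'a. x ^ Suc q = c}) < (\<Sum>c\<in>?C. Suc q)"
      using le2 c by (intro sum_strict_mono_ex1) auto
    then show False unfolding sum using C by simp
  qed
  ultimately show ?thesis by blast
qed

lemma card_fixed_field: "card fixed_field = q"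
  using card_fixed_field_and_norm_fibre by blast

lemma card_norm_fibre:
  "c \<in> fixed_field \<Longrightarrow> c \<noteq> 0 \<Longrightarrow> card {x::'a. x ^ Suc q = c} = Suc q"
  using card_fixed_field_and_norm_fibre by blast

lemma exists_trace_nonzero: "\<exists>x::'a. x + x ^ q \<noteq> 0"
proof (rule ccontr)
  assume "\<not> ?thesis"
  then have "{x::'a. x ^ q + 1 * x + 0 = 0} = UNIV" by (auto simp: add.commute)
  then have "CARD('a) \<le> q" using card_roots_le[of q "1::'a" 0] q_ge_2 by simp
  then show False using q_ge_2 by (simp add: card_field power2_eq_square)
qed

lemma exists_not_fixed: "\<exists>c::'a. c ^ q \<noteq> c"
proof (rule ccontr)
  assume "\<not> ?thesis"
  then have "fixed_field = UNIV" by (auto simp: fixed_field_def)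
  then show False using card_fixed_field q_ge_2 by (simp add: card_field power2_eq_square)
qed

section \<open>Sesquilinear calculus\<close>

lemma B_linear: "Vector_Spaces.linear (*s) (*) (\<lambda>u. B u v)"
  using hermitian unfolding hermitian_form_def by blast

lemma B_swap: "B v u = B u v ^ q"
  using hermitian unfolding hermitian_form_def by blast

lemma B_add_left: "B (u + v) w = B u w + B v w"
  using B_linear[of w] by (simp add: Vector_Spaces.linear_iff)

lemma B_scale_left: "B (c *s u) w = c * B u w"
  using B_linear[of w] by (simp add: Vector_Spaces.linear_iff)

lemma B_add_right: "B w (u + v) = B w u + B w v"
  by (simp add: B_swap[of w] B_add_left conj_add)

lemma B_scale_right: "B w (c *s u) = c ^ q * B w u"
  by (simp add: B_swap[of w] B_scale_left power_mult_distrib)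

lemma B_zero_left [simp]: "B 0 w = 0"
  using B_scale_left[of 0 0 w] by simp

lemma B_zero_right [simp]: "B w 0 = 0"
  using B_scale_right[of w 0 0] by simp

lemma B_minus_left: "B (- u) w = - B u w"
  using B_scale_left[of "-1" u w] by simp

lemma B_minus_right: "B w (- u) = - B w u"
  using B_add_right[of w u "- u"] by (simp add: eq_neg_iff_add_eq_0 add.commute)

lemma B_diff_left: "B (u - v) w = B u w - B v w"
  using B_add_left[of u "- v" w] by (simp add: B_minus_left)

lemma B_diff_right: "B w (u - v) = B w u - B w v"
  using B_add_right[of w u "- v"] by (simp add: B_minus_right)

lemmas B_simps = B_add_left B_add_right B_scale_left B_scale_right
  B_minus_left B_minus_right B_diff_left B_diff_right

lemma B_eq_0_swap: "B u v = 0 \<longleftrightarrow> B v u = 0"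
  by (metis B_swap conj_eq_0_iff)

lemma B_self_fixed: "B u u \<in> fixed_field"
  by (simp add: fixed_field_def flip: B_swap)

lemma B_eqI_left:
  assumes "\<And>w. B u w = B v w"
  shows "u = v"
proof -
  have "\<forall>w. B (u - v) w = 0" using assms by (simp add: B_diff_left)
  then have "u - v = 0" using nondegenerate unfolding nondegenerate_def by blast
  then show ?thesis by simp
qed

lemma B_eqI_right:
  assumes "\<And>w. B w u = B w v"
  shows "u = v"
  by (rule B_eqI_left) (metis assms B_swap)

section \<open>Orthogonality and non-degenerate subspaces\<close>

definition perp :: "('a^'n) set \<Rightarrow> ('a^'n) set" where
  "perp S = {u. \<forall>v\<in>S. B u v = 0}"

lemma subspace_perp: "vec.subspace (perp S)"
  by (simp add: vec.subspace_def perp_def B_add_left B_scale_left)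

lemma perp_span: "perp (vec.span S) = perp S"
proof
  show "perp S \<subseteq> perp (vec.span S)"
  proof
    fix u assume u: "u \<in> perp S"
    have "vec.subspace {v. B u v = 0}"
      by (simp add: vec.subspace_def B_add_right B_scale_right)
    then have "vec.span S \<subseteq> {v. B u v = 0}"
      using u by (intro vec.span_minimal) (auto simp: perp_def)
    then show "u \<in> perp (vec.span S)" by (auto simp: perp_def)
  qed
qed (auto simp: perp_def vec.span_base)

definition nondeg :: "('a^'n) set \<Rightarrow> bool" where
  "nondeg W \<longleftrightarrow> vec.subspace W \<and> W \<inter> perp W \<subseteq> {0}"

lemma nondeg_subspace: "nondeg W \<Longrightarrow> vec.subspace W"
  by (simp add: nondeg_def)

lemma nondeg_UNIV: "nondeg UNIV"
  using B_eqI_left[of _ 0] by (auto simp: nondeg_def perp_def)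

lemma nondeg_zero: "nondeg {0}"
  by (simp add: nondeg_def)

text \<open>If all of W were isotropic, then with B (c u) v = x of nonzero trace the vector c u + v
  would have norm x + x^q, a contradiction in every characteristic. A vector of nonzero norm is then
  rescaled, since the norm map of the field reaches every nonzero fixed element.\<close>

lemma exists_unit_vector:
  assumes W: "nondeg W" and "W \<noteq> {0}"
  shows "\<exists>e\<in>W. B e e = 1"
proof -
  have sub: "vec.subspace W" using W by (rule nondeg_subspace)
  have "\<exists>e\<in>W. B e e \<noteq> 0"
  proof (rule ccontr)
    assume "\<not> ?thesis"
    then have iso: "B w w = 0" if "w \<in> W" for w using that by blast
    obtain u where u: "u \<in> W" "u \<noteq> 0" using assms(2) vec.subspace_0[OF sub] by blast
    then have "u \<notin> perp W" using W by (auto simp: nondeg_def)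
    then obtain v where v: "v \<in> W" "B u v \<noteq> 0" using u by (auto simp: perp_def)
    obtain x :: 'a where x: "x + x ^ q \<noteq> 0" using exists_trace_nonzero by blast
    define c where "c = x / B u v"
    have "B (c *s u + v) (c *s u + v) = 0"
      using u v sub by (intro iso vec.subspace_add vec.subspace_scale)
    moreover have "B (c *s u) v = x" using v by (simp add: c_def B_scale_left)
    moreover have "B v (c *s u) = x ^ q" using B_swap[of v "c *s u"] calculation(2) by (simp only:)
    ultimately have "x + x ^ q = 0"
      using iso[OF u(1)] iso[OF v(1)] by (simp add: B_add_left B_add_right) (simp add: B_scale_left B_scale_right add.commute)
    then show False using x by simp
  qed
  then obtain e where e: "e \<in> W" "B e e \<noteq> 0" by blast
  have "(1 / B e e) ^ q = 1 / B e e"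
    using B_self_fixed[of e] by (simp add: fixed_field_def power_divide)
  then have "1 / B e e \<in> fixed_field - {0}" using e by (simp add: fixed_field_def)
  then have "card {x::'a. x ^ Suc q = 1 / B e e} = Suc q" by (intro card_norm_fibre) auto
  then have "{x::'a. x ^ Suc q = 1 / B e e} \<noteq> {}" by (metis card.empty nat.simps(3))
  then obtain d where d: "d ^ Suc q = 1 / B e e" by blast
  have "B (d *s e) (d *s e) = d ^ Suc q * B e e" by (simp add: B_scale_left B_scale_right)
  then have "B (d *s e) (d *s e) = 1" using d e by (simp del: power_Suc)
  then show ?thesis using e sub by (auto intro: vec.subspace_scale)
qed

lemma split_unit_vector:
  assumes W: "nondeg W" and e: "e \<in> W" "B e e = 1"
  defines "W' \<equiv> W \<inter> perp {e}"
  shows "nondeg W'" "bij_betw (\<lambda>(c, w). c *s e + w) (UNIV \<times> W') W"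
    "vec.dim W = Suc (vec.dim W')"
proof -
  have sub: "vec.subspace W" using W by (rule nondeg_subspace)
  have sub': "vec.subspace W'" unfolding W'_def
    by (intro vec.subspace_inter sub subspace_perp)
  have proj: "w - B w e *s e \<in> W'" if "w \<in> W" for w
    using that e sub by (auto simp: W'_def perp_def B_simps intro!: vec.subspace_diff vec.subspace_scale)
  show "nondeg W'"
    unfolding nondeg_def
  proof (intro conjI sub' subsetI)
    fix u assume u: "u \<in> W' \<inter> perp W'"
    have "B u w = 0" if "w \<in> W" for w
    proof -
      have "B u (w - B w e *s e) = 0" using u proj[OF that] by (auto simp: perp_def)
      then show ?thesis using u by (simp add: W'_def perp_def B_simps)
    qed
    then have "u \<in> W \<inter> perp W" using u by (auto simp: W'_def perp_def)
    then show "u \<in> {0}" using W by (auto simp: nondeg_def)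
  qed
  show bij: "bij_betw (\<lambda>(c, w). c *s e + w) (UNIV \<times> W') W"
    by (rule bij_betw_byWitness[where f' = "\<lambda>w. (B w e, w - B w e *s e)"])
      (use e proj sub in \<open>auto simp: W'_def perp_def B_simps vec.subspace_add vec.subspace_scale\<close>)
  have "card W = CARD('a) ^ Suc (vec.dim W')"
    using bij_betw_same_card[OF bij] by (simp add: card_cartesian_product card_subspace[OF sub'])
  then show "vec.dim W = Suc (vec.dim W')" by (simp only: dim_eq_iff_card[OF sub])
qed

section \<open>Vectors of norm 1\<close>

definition unit_vectors :: "('a^'n) set \<Rightarrow> ('a^'n) set" where
  "unit_vectors W = {v\<in>W. B v v = 1}"

text \<open>Write v = c e + w with w orthogonal to e, so that B w w = 1 - c^(q+1). The norm value 0
  comes from one scalar c and every other value of the fixed field from q + 1, while the fibres of w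
  -> B w w exhaust the complement. The term with factor q stands on the left to avoid subtraction on
  naturals.\<close>

lemma card_unit_vectors_step:
  assumes W: "nondeg W" and e: "e \<in> W" "B e e = 1"
  shows "card (unit_vectors W) + q * card (unit_vectors (W \<inter> perp {e})) =
    Suc q * card (W \<inter> perp {e})"
proof -
  let ?W = "W \<inter> perp {e}"
  define N where "N b = card {w\<in>?W. B w w = b}" for b
  note sp = split_unit_vector[OF W e]
  have "bij_betw (\<lambda>(c, w). c *s e + w) {x \<in> UNIV \<times> ?W. B (snd x) (snd x) = 1 - fst x ^ Suc q} (unit_vectors W)"
    unfolding bij_betw_def
  proof
    show "inj_on (\<lambda>(c, w). c *s e + w) {x \<in> UNIV \<times> ?W. B (snd x) (snd x) = 1 - fst x ^ Suc q}"
      by (rule inj_on_subset[OF bij_betw_imp_inj_on[OF sp(2)]]) auto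
    have nrm: "B (c *s e + w) (c *s e + w) = c ^ Suc q + B w w" if "w \<in> ?W" for c w
      using that e B_eq_0_swap[of w e] by (simp add: perp_def B_simps)
    show "(\<lambda>(c, w). c *s e + w) ` {x \<in> UNIV \<times> ?W. B (snd x) (snd x) = 1 - fst x ^ Suc q} = unit_vectors W"
    proof (intro equalityI subsetI)
      fix v assume "v \<in> (\<lambda>(c, w). c *s e + w) ` {x \<in> UNIV \<times> ?W. B (snd x) (snd x) = 1 - fst x ^ Suc q}"
      then obtain c w where v: "v = c *s e + w" "w \<in> ?W" "B w w = 1 - c ^ Suc q" by auto
      have "v \<in> (\<lambda>(c, w). c *s e + w) ` (UNIV \<times> ?W)"
        using v(1,2) by (intro image_eqI[of _ _ "(c, w)"]) auto
      then have "v \<in> W" by (simp only: bij_betw_imp_surj_on[OF sp(2)])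
      moreover have "B v v = 1" unfolding v(1) nrm[OF v(2)] v(3) by simp
      ultimately show "v \<in> unit_vectors W" by (simp add: unit_vectors_def)
    next
      fix v assume v: "v \<in> unit_vectors W"
      then have "v \<in> (\<lambda>(c, w). c *s e + w) ` (UNIV \<times> ?W)"
        unfolding bij_betw_imp_surj_on[OF sp(2)] by (simp add: unit_vectors_def)
      then obtain c w where cw: "v = c *s e + w" "w \<in> ?W" by auto
      have "c ^ Suc q + B w w = 1" using v nrm[OF cw(2), of c] cw(1) by (simp add: unit_vectors_def)
      then have "B w w = 1 - c ^ Suc q" by (simp add: eq_diff_eq add.commute)
      then show "v \<in> (\<lambda>(c, w). c *s e + w) ` {x \<in> UNIV \<times> ?W. B (snd x) (snd x) = 1 - fst x ^ Suc q}"
        using cw by force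
    qed
  qed
  from bij_betw_same_card[OF this]
  have "card (unit_vectors W) = card {x \<in> UNIV \<times> ?W. B (snd x) (snd x) = 1 - fst x ^ Suc q}" by simp
  also have "{x \<in> UNIV \<times> ?W. B (snd x) (snd x) = 1 - fst x ^ Suc q} =
      (SIGMA c:UNIV. {w\<in>?W. B w w = 1 - c ^ Suc q})" by auto
  also have "card \<dots> = (\<Sum>c\<in>UNIV. N (1 - c ^ Suc q))"
    unfolding N_def by (rule card_SigmaI) auto
  also have "\<dots> = (\<Sum>n\<in>fixed_field. \<Sum>c | c \<in> UNIV \<and> c ^ Suc q = n. N (1 - c ^ Suc q))"
    using norm_in_fixed_field by (intro sum.group[symmetric]) auto
  also have "\<dots> = (\<Sum>n\<in>fixed_field. card {c::'a. c ^ Suc q = n} * N (1 - n))"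
    by (intro sum.cong refl) simp
  also have "\<dots> = N 1 + (\<Sum>n\<in>fixed_field - {0}. Suc q * N (1 - n))"
    by (subst sum.remove[of _ 0]) (auto simp: fixed_field_def card_norm_fibre simp del: power_Suc)
  also have "\<dots> = N 1 + Suc q * (\<Sum>n\<in>fixed_field - {0}. N (1 - n))"
    by (simp only: sum_distrib_left)
  finally have 1: "card (unit_vectors W) = N 1 + Suc q * (\<Sum>n\<in>fixed_field - {0}. N (1 - n))" .
  have "(\<Sum>n\<in>fixed_field. N (1 - n)) = (\<Sum>n\<in>fixed_field. N n)"
    by (rule sum.reindex_bij_witness[where i = "\<lambda>n. 1 - n" and j = "\<lambda>n. 1 - n"])
      (auto simp: fixed_field_def conj_diff)
  also have "\<dots> = card (\<Union>n\<in>fixed_field. {w\<in>?W. B w w = n})"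
    unfolding N_def by (rule card_UN_disjoint[symmetric]) auto
  also have "(\<Union>n\<in>fixed_field. {w\<in>?W. B w w = n}) = ?W" using B_self_fixed by auto
  finally have "(\<Sum>n\<in>fixed_field. N (1 - n)) = card ?W" .
  then have 2: "card ?W = N 1 + (\<Sum>n\<in>fixed_field - {0}. N (1 - n))"
    by (subst (asm) sum.remove[of _ 0]) (auto simp: fixed_field_def)
  have "N 1 = card (unit_vectors ?W)" by (simp add: N_def unit_vectors_def)
  then show ?thesis using 1 2 by (simp add: algebra_simps)
qed

lemma dim_zero_iff: "vec.subspace W \<Longrightarrow> vec.dim W = 0 \<longleftrightarrow> W = {0}"
  for W :: "('a^'n) set"
  by (metis dim_eq_iff_card card_1_singleton_iff power_0 singletonD vec.subspace_0 is_singletonI is_singleton_altdef)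

text \<open>U_(k+1)(q) is transitive on unit vectors with stabiliser U_k(q). Here the ratio of the
  orders comes from solving the recursion of \<open>card_unit_vectors_step\<close>.\<close>

lemma card_unit_vectors:
  assumes "nondeg W" "vec.dim W = Suc k"
  shows "real (card (unit_vectors W)) * unitary_order q k = unitary_order q (Suc k)"
proof -
  define y where "y = - 1 / real q"
  have q: "real q \<noteq> 0" using q_ge_2 by simp
  have y: "real q * y = - 1" using q by (simp add: y_def)
  \<comment> \<open>The extra factor q replaces the exponent 2k - 1, which is not a natural number
    at k = 0.\<close>
  have closed: "real q * real (card (unit_vectors W)) = real q ^ (2 * vec.dim W) * (1 - y ^ vec.dim W)"
    if "nondeg W" for W
    using that
  proof (induction "vec.dim W" arbitrary: W)
    case 0
    then have "W = {0}" using dim_zero_iff nondeg_subspace by metis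
    then show ?case using 0 by (simp add: unit_vectors_def)
  next
    case (Suc k)
    then have "W \<noteq> {0}" using dim_zero_iff nondeg_subspace by (metis nat.simps(3))
    then obtain e where e: "e \<in> W" "B e e = 1" using exists_unit_vector Suc.prems by blast
    note sp = split_unit_vector[OF Suc.prems e]
    let ?W = "W \<inter> perp {e}"
    have k: "vec.dim ?W = k" using sp(3) Suc.hyps(2) by simp
    have "real q * real (card (unit_vectors ?W)) = real q ^ (2 * k) * (1 - y ^ k)"
      using Suc.hyps(1)[of ?W] sp(1) k by simp
    moreover have "real (card (unit_vectors W) + q * card (unit_vectors ?W)) = real (Suc q * card ?W)"
      using card_unit_vectors_step[OF Suc.prems e] by simp
    moreover have "real (card ?W) = real q ^ (2 * k)"
      using card_subspace[OF nondeg_subspace[OF sp(1)]] k by (simp add: card_field power_mult)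
    ultimately have "real (card (unit_vectors W)) = real q ^ (2 * k) * (real q + y ^ k)"
      by (simp add: algebra_simps)
    then have "real q * real (card (unit_vectors W)) = real q ^ (2 * k) * (real q * (real q + y ^ k))"
      by (simp only: mult_ac)
    also have "real q * (real q + y ^ k) = real q * (real q - (real q * y) * y ^ k)"
      unfolding y by simp
    also have "\<dots> = real q ^ 2 * (1 - y ^ Suc k)"
      by (simp add: algebra_simps power2_eq_square)
    also have "real q ^ (2 * k) * \<dots> = real q ^ (2 * Suc k) * (1 - y ^ Suc k)"
      by (simp only: mult.assoc[symmetric] power_add[symmetric]) simp
    finally show ?case using Suc.hyps(2) by simp
  qed
  have "real q * (real (card (unit_vectors W)) * unitary_order q k) = real q * unitary_order q (Suc k)"
  proof -
    have "real q ^ (2 * Suc k) * real q ^ (k * k) = real q * real q ^ (Suc k * Suc k)"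
      unfolding power_add[symmetric] power_Suc[symmetric]
      by (rule arg_cong[where f = "\<lambda>i. real q ^ i"]) simp
    then have "real q ^ (2 * Suc k) * real q ^ (k * k) * (qp k * (1 - y ^ Suc k)) =
        real q * real q ^ (Suc k * Suc k) * (qp k * (1 - y ^ Suc k))"
      by (simp only:)
    then show ?thesis
      unfolding mult.assoc[symmetric] closed[OF assms(1)] assms(2)
      unfolding unitary_order_def y_def[symmetric] q_pochhammer_Suc by (simp only: mult_ac)
  qed
  then show ?thesis using q by simp
qed

lemma unitary_order_nz: "unitary_order q k \<noteq> 0"
  using q_ge_2 qp_nz by (simp add: unitary_order_def)

section \<open>Orthonormal lists and the subspaces they span\<close>

fun orthonormal :: "('a^'n) list \<Rightarrow> bool" where
  "orthonormal [] \<longleftrightarrow> True"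
| "orthonormal (x # xs) \<longleftrightarrow> B x x = 1 \<and> (\<forall>v\<in>set xs. B v x = 0) \<and> orthonormal xs"

lemma finite_lists_in: "finite {xs :: ('a^'n) list. P xs \<and> set xs \<subseteq> W \<and> length xs = r}"
  by (rule finite_subset[OF _ finite_lists_length_eq[of W r]]) auto

text \<open>Once the head x is chosen, the tail is an orthonormal list in the complement of x, of
  dimension one less; the ratios from \<open>card_unit_vectors\<close> telescope.\<close>

lemma card_orthonormal:
  assumes "nondeg W" "r \<le> vec.dim W"
  shows "real (card {xs. orthonormal xs \<and> set xs \<subseteq> W \<and> length xs = r}) * unitary_order q (vec.dim W - r) =
    unitary_order q (vec.dim W)"
  using assms
proof (induction r arbitrary: W)
  case 0
  have "{xs. orthonormal xs \<and> set xs \<subseteq> W \<and> length xs = 0} = {[]}" by auto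
  then show ?case by simp
next
  case (Suc r)
  let ?L = "\<lambda>W r. {xs. orthonormal xs \<and> set xs \<subseteq> W \<and> length xs = r}"
  obtain k where k: "vec.dim W = Suc k" using Suc.prems(2) by (cases "vec.dim W") auto
  have "?L W (Suc r) = (\<lambda>(x, xs). x # xs) ` (SIGMA x:unit_vectors W. ?L (W \<inter> perp {x}) r)"
    by (auto simp: length_Suc_conv image_iff unit_vectors_def perp_def)
  moreover have "inj_on (\<lambda>(x, xs). x # xs) (SIGMA x:unit_vectors W. ?L (W \<inter> perp {x}) r)"
    by (auto simp: inj_on_def)
  ultimately have "card (?L W (Suc r)) = card (SIGMA x:unit_vectors W. ?L (W \<inter> perp {x}) r)"
    by (simp only: card_image)
  also have "\<dots> = (\<Sum>x\<in>unit_vectors W. card (?L (W \<inter> perp {x}) r))"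
    by (rule card_SigmaI) (auto intro: finite_lists_in)
  finally have "real (card (?L W (Suc r))) * unitary_order q (k - r) =
      (\<Sum>x\<in>unit_vectors W. real (card (?L (W \<inter> perp {x}) r)) * unitary_order q (k - r))"
    by (simp add: sum_distrib_right)
  also have "\<dots> = (\<Sum>x\<in>unit_vectors W. unitary_order q k)"
  proof (intro sum.cong refl)
    fix x assume "x \<in> unit_vectors W"
    then have x: "x \<in> W" "B x x = 1" by (auto simp: unit_vectors_def)
    note sp = split_unit_vector[OF Suc.prems(1) x]
    have "vec.dim (W \<inter> perp {x}) = k" using sp(3) k by simp
    then show "real (card (?L (W \<inter> perp {x}) r)) * unitary_order q (k - r) = unitary_order q k"
      using Suc.IH[OF sp(1)] Suc.prems(2) k by simp
  qed
  also have "\<dots> = unitary_order q (Suc k)"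
    using card_unit_vectors[OF Suc.prems(1) k] by simp
  finally show ?case using k by simp
qed

lemma orthonormal_imp_indep: "orthonormal xs \<Longrightarrow> indep_list xs"
proof (induction xs)
  case (Cons x xs)
  have "vec.subspace {u. B u x = 0}"
    by (simp add: vec.subspace_def B_add_left B_scale_left)
  then have "vec.span (set xs) \<subseteq> {u. B u x = 0}"
    using Cons.prems by (intro vec.span_minimal) auto
  then show ?case using Cons by auto
qed simp

lemma nondeg_span_orthonormal: "orthonormal xs \<Longrightarrow> nondeg (vec.span (set xs))"
proof (induction xs)
  case Nil
  then show ?case by (simp add: nondeg_zero)
next
  case (Cons x xs)
  have x: "x \<in> perp (vec.span (set xs))"
    unfolding perp_span using Cons.prems B_eq_0_swap[of x] by (auto simp: perp_def)
  have "u = 0" if u: "u \<in> vec.span (insert x (set xs))" "u \<in> perp (insert x (set xs))" for u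
  proof -
    obtain k where k: "u - k *s x \<in> vec.span (set xs)" using u(1) by (auto simp: vec.span_insert)
    then have "B (u - k *s x) x = 0" using x B_eq_0_swap[of x] by (auto simp: perp_def)
    then have "k = 0" using u(2) Cons.prems by (simp add: B_simps perp_def)
    then have "u \<in> vec.span (set xs) \<inter> perp (vec.span (set xs))"
      using k u(2) unfolding perp_span by (simp add: perp_def)
    then show ?thesis using Cons by (auto simp: nondeg_def)
  qed
  then show ?case unfolding nondeg_def perp_span by auto
qed

lemma span_orthonormal_eq:
  assumes "nondeg W" "orthonormal xs" "set xs \<subseteq> W" "length xs = vec.dim W"
  shows "vec.span (set xs) = W"
  using assms dim_span_indep_list[OF orthonormal_imp_indep[OF assms(2)]] nondeg_subspace
  by (intro subspace_eqI vec.span_minimal) auto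

text \<open>Existence by counting: the number of full-length orthonormal lists is nonzero because
  \<open>unitary_order\<close> is.\<close>

lemma nondeg_obtains_orthonormal:
  assumes "nondeg W"
  obtains xs where "orthonormal xs" "vec.span (set xs) = W" "length xs = vec.dim W"
proof -
  have "{xs. orthonormal xs \<and> set xs \<subseteq> W \<and> length xs = vec.dim W} \<noteq> {}"
    using card_orthonormal[OF assms order_refl] unitary_order_nz[of "vec.dim W"] by fastforce
  then show ?thesis using that span_orthonormal_eq[OF assms] by blast
qed

text \<open>Orthogonal projection along an orthonormal basis of I, one basis vector per induction
  step.\<close>

lemma nondeg_decompose:
  assumes "nondeg I"
  shows "\<exists>a\<in>I. u - a \<in> perp I"
proof -
  obtain xs where xs: "orthonormal xs" "vec.span (set xs) = I"
    using nondeg_obtains_orthonormal[OF assms] by blast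
  have "\<exists>a\<in>vec.span (set xs). u - a \<in> perp (vec.span (set xs))"
    using xs(1)
  proof (induction xs)
    case Nil
    then show ?case by (simp add: perp_def)
  next
    case (Cons x xs)
    then obtain a where a: "a \<in> vec.span (set xs)" "u - a \<in> perp (vec.span (set xs))" by auto
    have x: "x \<in> perp (vec.span (set xs))"
      unfolding perp_span using Cons.prems B_eq_0_swap[of x] by (auto simp: perp_def)
    then have "B a x = 0" using a B_eq_0_swap[of a x] by (auto simp: perp_def)
    then have "u - (a + B u x *s x) \<in> perp (insert x (set xs))"
      using a(2) x Cons.prems unfolding perp_span by (simp add: perp_def B_simps)
    moreover have "a + B u x *s x \<in> vec.span (insert x (set xs))"
    proof (intro vec.span_add vec.span_scale)
      show "a \<in> vec.span (insert x (set xs))"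
        using a(1) vec.span_mono[of "set xs" "insert x (set xs)"] by blast
      show "x \<in> vec.span (insert x (set xs))" by (simp add: vec.span_base)
    qed
    ultimately show ?case unfolding perp_span by auto
  qed
  then show ?thesis by (simp add: xs(2))
qed

lemma nondeg_complement:
  assumes W: "nondeg W" and I: "nondeg I" "I \<subseteq> W"
  shows "nondeg (W \<inter> perp I)" "vec.dim (W \<inter> perp I) = vec.dim W - vec.dim I"
proof -
  have sub: "vec.subspace W" "vec.subspace I" "vec.subspace (W \<inter> perp I)"
    using W I by (auto intro: nondeg_subspace vec.subspace_inter subspace_perp)
  have dec: "\<exists>a\<in>I. w - a \<in> W \<inter> perp I" if "w \<in> W" for w
    using nondeg_decompose[OF I(1), of w] that I(2) sub(1) by (auto intro: vec.subspace_diff)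
  show "nondeg (W \<inter> perp I)" unfolding nondeg_def
  proof (intro conjI sub subsetI)
    fix u assume u: "u \<in> W \<inter> perp I \<inter> perp (W \<inter> perp I)"
    have "B u w = 0" if w: "w \<in> W" for w
    proof -
      obtain a where a: "a \<in> I" "w - a \<in> W \<inter> perp I" using dec[OF w] by blast
      then have "B u a = 0" "B u (w - a) = 0" using u by (auto simp: perp_def)
      then show ?thesis by (simp add: B_diff_right)
    qed
    then show "u \<in> {0}" using u W by (auto simp: nondeg_def perp_def)
  qed
  have "bij_betw (\<lambda>(a, b). a + b) (I \<times> (W \<inter> perp I)) W"
    unfolding bij_betw_def
  proof (intro conjI inj_onI equalityI subsetI)
    fix x y assume xy: "x \<in> I \<times> (W \<inter> perp I)" "y \<in> I \<times> (W \<inter> perp I)"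
      "(\<lambda>(a, b). a + b) x = (\<lambda>(a, b). a + b) y"
    obtain a b a' b' where [simp]: "x = (a, b)" "y = (a', b')" by (cases x, cases y)
    have "a - a' = b' - b" using xy by (simp add: algebra_simps)
    moreover have "a - a' \<in> I" using xy sub by (auto intro: vec.subspace_diff)
    moreover have "b' - b \<in> perp I" using xy subspace_perp by (auto intro: vec.subspace_diff)
    ultimately have "a - a' = 0" using I(1) by (auto simp: nondeg_def)
    then show "x = y" using xy by simp
  next
    fix w assume "w \<in> W"
    then obtain a where "a \<in> I" "w - a \<in> W \<inter> perp I" using dec by blast
    then show "w \<in> (\<lambda>(a, b). a + b) ` (I \<times> (W \<inter> perp I))"
      by (intro image_eqI[of _ _ "(a, w - a)"]) auto
  next
    fix w assume "w \<in> (\<lambda>(a, b). a + b) ` (I \<times> (W \<inter> perp I))"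
    then show "w \<in> W" using I(2) sub by (auto intro: vec.subspace_add)
  qed
  from bij_betw_same_card[OF this]
  have "card W = CARD('a) ^ (vec.dim I + vec.dim (W \<inter> perp I))"
    using sub by (simp add: card_cartesian_product card_subspace power_add)
  then have "vec.dim W = vec.dim I + vec.dim (W \<inter> perp I)"
    by (simp only: dim_eq_iff_card[OF sub(1)])
  then show "vec.dim (W \<inter> perp I) = vec.dim W - vec.dim I" by simp
qed

text \<open>Orthonormal lists of length r are sorted by their span, and each span carries |U_r(q)|
  of them. The quotient is the index of U_r x U_(k-r) in U_k.\<close>

lemma card_nondeg_subspaces:
  assumes W: "nondeg W" and r: "r \<le> vec.dim W"
  shows "real (card {I. nondeg I \<and> I \<subseteq> W \<and> vec.dim I = r}) =
    unitary_order q (vec.dim W) / (unitary_order q r * unitary_order q (vec.dim W - r))"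
proof -
  let ?L = "\<lambda>W. {xs. orthonormal xs \<and> set xs \<subseteq> W \<and> length xs = r}"
  let ?G = "{I. nondeg I \<and> I \<subseteq> W \<and> vec.dim I = r}"
  have span: "vec.span (set xs) = J" if "J \<in> ?G" "xs \<in> ?L J" for J xs
    using that span_orthonormal_eq[of J xs] by simp
  have "?L W = (\<Union>J\<in>?G. ?L J)"
  proof (intro equalityI subsetI)
    fix xs assume xs: "xs \<in> ?L W"
    then have "vec.span (set xs) \<in> ?G"
      using nondeg_subspace[OF W] dim_span_indep_list[OF orthonormal_imp_indep, of xs]
        nondeg_span_orthonormal[of xs]
      by (auto intro: vec.span_minimal[THEN subsetD])
    then show "xs \<in> (\<Union>J\<in>?G. ?L J)"
      using xs by (auto intro!: bexI[of _ "vec.span (set xs)"] vec.span_base)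
  qed auto
  then have "card (?L W) = (\<Sum>J\<in>?G. card (?L J))"
  proof (simp only:, intro card_UN_disjoint ballI impI)
    fix I J assume IJ: "I \<in> ?G" "J \<in> ?G" "I \<noteq> J"
    show "?L I \<inter> ?L J = {}" using span[OF IJ(1)] span[OF IJ(2)] IJ(3) by blast
  qed (auto intro: finite_lists_in)
  then have "real (card (?L W)) = (\<Sum>J\<in>?G. real (card (?L J)))" by simp
  also have "\<dots> = (\<Sum>J\<in>?G. unitary_order q r)"
  proof (intro sum.cong refl)
    fix J assume "J \<in> ?G"
    then show "real (card (?L J)) = unitary_order q r"
      using card_orthonormal[of J r] by (simp add: unitary_order_def)
  qed
  finally have "real (card (?L W)) = real (card ?G) * unitary_order q r" by simp
  then show ?thesis
    using card_orthonormal[OF W r] unitary_order_nz by (simp add: divide_simps mult_ac)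
qed

lemma sum_over_nondeg_subspaces:
  fixes f :: "nat \<Rightarrow> real"
  assumes W: "nondeg W"
  shows "(\<Sum>I | nondeg I \<and> I \<subseteq> W. f (vec.dim I)) =
    (\<Sum>r\<le>vec.dim W. unitary_order q (vec.dim W) / (unitary_order q r * unitary_order q (vec.dim W - r)) * f r)"
proof -
  have "(\<Sum>I | nondeg I \<and> I \<subseteq> W. f (vec.dim I)) =
    (\<Sum>r\<le>vec.dim W. \<Sum>I | I \<in> {I. nondeg I \<and> I \<subseteq> W} \<and> vec.dim I = r. f (vec.dim I))"
    by (rule sum.group[symmetric]) (auto intro: vec.dim_subset)
  also have "\<dots> = (\<Sum>r\<le>vec.dim W. real (card {I. nondeg I \<and> I \<subseteq> W \<and> vec.dim I = r}) * f r)"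
    by (intro sum.cong refl) (simp add: conj_assoc)
  also have "\<dots> = (\<Sum>r\<le>vec.dim W. unitary_order q (vec.dim W) / (unitary_order q r * unitary_order q (vec.dim W - r)) * f r)"
    by (intro sum.cong refl) (simp add: card_nondeg_subspaces[OF W])
  finally show ?thesis .
qed

end

section \<open>Self-adjoint maps\<close>

text \<open>With Q = q^2 and y^2 = 1/Q, \<open>E k\<close> is the product of 1 - Q^(-i) over i =
  1..k. Each factor Q^k - Q^l is Q^k (1 - Q^(l-k)), so the left side completes
  \<open>E (k - r)\<close> to \<open>E k\<close>.\<close>

lemma prod_card_diff:
  fixes q :: nat and y :: real
  assumes q: "q \<ge> 2" and r: "r \<le> k"
  defines "y \<equiv> - 1 / real q" and "E \<equiv> (\<lambda>k. q_pochhammer (- 1 / real q) k * q_pochhammer_plus (- 1 / real q) k)"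
  shows "(\<Prod>l<r. real (q ^ 2) ^ k - real (q ^ 2) ^ l) * E (k - r) = real q ^ (2 * k * r) * E k"
  using r
proof (induction r)
  case (Suc r)
  define Q where "Q = real (q ^ 2)"
  have Q: "Q > 0" using q by (simp add: Q_def)
  obtain d where "k = Suc r + d" using Suc.prems le_Suc_ex by blast
  then have d: "k = Suc d + r" by simp
  have "(\<Prod>l<Suc r. Q ^ k - Q ^ l) * E (k - Suc r) = (\<Prod>l<r. Q ^ k - Q ^ l) * ((Q ^ k - Q ^ r) * E d)"
  proof -
    have "k - Suc r = d" using d by simp
    then show ?thesis by (simp only: prod.lessThan_Suc mult.assoc)
  qed
  also have "(Q ^ k - Q ^ r) * E d = Q ^ k * E (Suc d)"
  proof -
    have yy: "y * y = 1 / Q" by (simp add: y_def Q_def power2_eq_square)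
    have "y ^ Suc d * y ^ Suc d = (y * y) ^ Suc d" by (simp only: power_mult_distrib)
    also have "\<dots> = 1 / Q ^ Suc d" unfolding yy by (rule power_one_over)
    finally have "(1 - y ^ Suc d) * (1 + y ^ Suc d) = 1 - 1 / Q ^ Suc d"
      by (simp add: algebra_simps)
    moreover have "E (Suc d) = E d * ((1 - y ^ Suc d) * (1 + y ^ Suc d))"
      unfolding E_def q_pochhammer_Suc q_pochhammer_plus_Suc y_def[symmetric] by (simp only: mult_ac)
    ultimately have "Q ^ k * E (Suc d) = (Q ^ k * (1 - 1 / Q ^ Suc d)) * E d"
      by (simp only: mult_ac)
    also have "Q ^ k * (1 - 1 / Q ^ Suc d) = Q ^ k - Q ^ r"
      using Q unfolding d power_add by (simp add: field_simps)
    finally show ?thesis ..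
  qed
  also have "(\<Prod>l<r. Q ^ k - Q ^ l) * (Q ^ k * E (Suc d)) = ((\<Prod>l<r. Q ^ k - Q ^ l) * E (Suc d)) * Q ^ k"
    by (simp only: mult_ac)
  also have "(\<Prod>l<r. Q ^ k - Q ^ l) * E (Suc d) = real q ^ (2 * k * r) * E k"
  proof -
    have "k - r = Suc d" "r \<le> k" using d by simp_all
    then show ?thesis using Suc.IH unfolding Q_def by (simp only:)
  qed
  finally have step: "(\<Prod>l<Suc r. Q ^ k - Q ^ l) * E (k - Suc r) = real q ^ (2 * k * r) * E k * Q ^ k" .
  have pw: "real q ^ (2 * k * Suc r) = real q ^ (2 * k * r) * Q ^ k"
    by (simp add: power_add Q_def power_mult)
  show ?case unfolding pw Q_def[symmetric] step by (simp only: mult_ac)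
qed (simp add: E_def)

context hermitian_space
begin

section \<open>Functionals represented by the form\<close>

lemma B_sum_left: "B (sum f A) w = (\<Sum>i\<in>A. B (f i) w)"
  by (induction A rule: infinite_finite_induct) (auto simp: B_add_left)

text \<open>T sends w to the values of the functional u -> B u w on the standard basis. It is only
  conjugate-linear in w, so surjectivity is drawn from injectivity on a finite set.\<close>

lemma riesz_representation:
  assumes "Vector_Spaces.linear (*s) (*) (\<phi> :: 'a^'n \<Rightarrow> 'a)"
  shows "\<exists>w. \<forall>u. \<phi> u = B u w"
proof -
  define T where "T w = (\<chi> i. B (axis i 1) w)" for w
  have expand: "B u w = (\<Sum>i\<in>UNIV. u $ i * T w $ i)" for u w
    by (subst basis_expansion[of u, symmetric]) (simp add: B_sum_left B_scale_left T_def)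
  have "inj T"
  proof (rule injI)
    fix v w assume "T v = T w"
    then have "B u v = B u w" for u by (simp add: expand)
    then show "v = w" by (rule B_eqI_right)
  qed
  then have "surj T" by (simp add: finite_UNIV_inj_surj)
  then obtain w where w: "T w = (\<chi> i. \<phi> (axis i 1))" by (metis surjD)
  interpret Vector_Spaces.linear "(*s)" "(*)" \<phi> by (rule assms)
  have "\<phi> u = B u w" for u
  proof -
    have "\<phi> u = \<phi> (\<Sum>i\<in>UNIV. u $ i *s axis i 1)" by (simp add: basis_expansion)
    then show ?thesis by (simp add: expand w sum scale)
  qed
  then show ?thesis by blast
qed

lemma exists_dual_vector:
  assumes W: "vec.subspace W" and e: "e \<notin> W"
  shows "\<exists>u\<in>perp W. B e u = 1"
proof -
  obtain S where S: "S \<subseteq> W" "vec.independent S" "W \<subseteq> vec.span S"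
    by (rule vec.basis_exists)
  have span: "vec.span S = W"
    using S W by (intro antisym) (auto intro: vec.span_minimal[THEN subsetD])
  have "vec.independent (insert e S)" using S(2) e span by (simp add: vec.independent_insert)
  \<comment> \<open>The extension is vector-valued: the functional is encoded in the coordinate
    \<open>undefined\<close>, with \<open>axis undefined 1\<close> standing for the value 1.\<close>
  from vec.linear_independent_extend[OF this, of "\<lambda>x. if x = e then axis undefined 1 else 0"]
  obtain g :: "'a^'n \<Rightarrow> 'a^'n" where g: "Vector_Spaces.linear (*s) (*s) g"
    "\<And>x. x \<in> insert e S \<Longrightarrow> g x = (if x = e then axis undefined 1 else 0)" by blast
  define \<phi> where "\<phi> u = g u $ undefined" for u
  have "Vector_Spaces.linear (*s) (*) \<phi>"
    using g(1)
    by (simp add: Vector_Spaces.linear_iff \<phi>_def vector_space_over_itself.vector_space_axioms)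
  then obtain w where w: "\<And>u. \<phi> u = B u w" using riesz_representation by blast
  have "e \<notin> S" using S e by blast
  then have "B s w = 0" if "s \<in> S" for s using that g(2)[of s] by (auto simp flip: w simp: \<phi>_def)
  then have "w \<in> perp S" using B_eq_0_swap by (auto simp: perp_def)
  then have "w \<in> perp W" using perp_span[of S] span by simp
  moreover have "B e w = 1" using g(2)[of e] by (simp flip: w add: \<phi>_def)
  ultimately show ?thesis by blast
qed

text \<open>Plain functions: linearity follows from non-degeneracy in
  \<open>self_adjoint_add\<close> and \<open>self_adjoint_scale\<close>. Via (u, v) -> B (f u) v
  these maps correspond to Hermitian forms on V.\<close>

definition self_adjoint :: "('a^'n \<Rightarrow> 'a^'n) set" where
  "self_adjoint = {f. \<forall>u v. B (f u) v = B u (f v)}"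

lemma self_adjointD: "f \<in> self_adjoint \<Longrightarrow> B (f u) v = B u (f v)"
  by (simp add: self_adjoint_def)

lemma self_adjoint_add:
  assumes "f \<in> self_adjoint"
  shows "f (u + v) = f u + f v"
  by (rule B_eqI_left) (simp add: self_adjointD[OF assms] B_add_left)

lemma self_adjoint_scale:
  assumes "f \<in> self_adjoint"
  shows "f (c *s u) = c *s f u"
  by (rule B_eqI_left) (simp add: self_adjointD[OF assms] B_scale_left)

lemma self_adjoint_zero: "f \<in> self_adjoint \<Longrightarrow> f 0 = 0"
  using self_adjoint_scale[of f 0 0] by simp

lemma self_adjoint_diff:
  assumes "f \<in> self_adjoint"
  shows "f (u - v) = f u - f v"
  by (rule B_eqI_left) (simp add: self_adjointD[OF assms] B_diff_left)

lemma self_adjoint_plus: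
  "f \<in> self_adjoint \<Longrightarrow> g \<in> self_adjoint \<Longrightarrow> (\<lambda>u. f u + g u) \<in> self_adjoint"
  by (simp add: self_adjoint_def B_add_left B_add_right)

lemma self_adjoint_minus:
  "f \<in> self_adjoint \<Longrightarrow> g \<in> self_adjoint \<Longrightarrow> (\<lambda>u. f u - g u) \<in> self_adjoint"
  by (simp add: self_adjoint_def B_diff_left B_diff_right)

lemma subspace_range_self_adjoint:
  assumes "f \<in> self_adjoint"
  shows "vec.subspace (range f)"
  unfolding vec.subspace_def
proof (intro conjI allI ballI)
  show "0 \<in> range f" using self_adjoint_zero[OF assms] by (metis rangeI)
  fix x y c assume "x \<in> range f"
  then obtain u where u: "x = f u" by blast
  show "c *s x \<in> range f" unfolding u self_adjoint_scale[OF assms, symmetric] by blast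
  assume "y \<in> range f"
  then obtain v where v: "y = f v" by blast
  show "x + y \<in> range f" unfolding u v self_adjoint_add[OF assms, symmetric] by blast
qed

lemma self_adjoint_eq_0_iff:
  assumes "f \<in> self_adjoint"
  shows "f u = 0 \<longleftrightarrow> u \<in> perp (range f)"
  using B_eqI_left[of "f u" 0] by (auto simp: perp_def self_adjointD[OF assms, symmetric])

section \<open>Counting self-adjoint maps with prescribed range\<close>

definition self_adjoint_into :: "('a^'n) set \<Rightarrow> ('a^'n \<Rightarrow> 'a^'n) set" where
  "self_adjoint_into W = {f \<in> self_adjoint. range f \<subseteq> W}"

definition self_adjoint_onto :: "('a^'n) set \<Rightarrow> ('a^'n \<Rightarrow> 'a^'n) set" where
  "self_adjoint_onto W = {f \<in> self_adjoint. range f = W}"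

lemma self_adjoint_into_kills_perp:
  assumes "f \<in> self_adjoint_into W" "u \<in> perp W"
  shows "f u = 0"
  using assms self_adjoint_eq_0_iff[of f u] by (auto simp: self_adjoint_into_def perp_def)

text \<open>The contribution of one new row and column of a Hermitian matrix: w holds the
  off-diagonal entries and c the diagonal one.\<close>

definition hyperbolic :: "'a^'n \<Rightarrow> 'a^'n \<Rightarrow> 'a \<Rightarrow> 'a^'n \<Rightarrow> 'a^'n" where
  "hyperbolic e w c u = B u w *s e + B u e *s w + (c * B u e) *s e"

lemma self_adjoint_hyperbolic:
  assumes "c \<in> fixed_field"
  shows "hyperbolic e w c \<in> self_adjoint"
proof -
  have "B (hyperbolic e w c u) v = B u (hyperbolic e w c v)" for u v
    using assms B_swap[of w v] B_swap[of e v]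
    by (simp add: hyperbolic_def B_add_left B_add_right B_scale_left B_scale_right
        power_mult_distrib fixed_field_def)
  then show ?thesis by (simp add: self_adjoint_def)
qed

text \<open>Bordering a Hermitian matrix, for W possibly degenerate. Take z orthogonal to W with B e
  z = 1. The value f z = w + c e determines the hyperbolic part; the remainder g kills z, so by
  self-adjointness its range is orthogonal to z and thus lies in W. There are |W| choices of w and q
  of c.\<close>

lemma card_self_adjoint_into_step:
  assumes W: "vec.subspace W" and e: "e \<notin> W"
  shows "card (self_adjoint_into (vec.span (insert e W))) = card (self_adjoint_into W) * (card W * q)"
proof -
  obtain z where z: "z \<in> perp W" "B e z = 1" using exists_dual_vector[OF W e] by blast
  have z': "B z e = 1" "\<And>w. w \<in> W \<Longrightarrow> B z w = 0" "\<And>w. w \<in> W \<Longrightarrow> B w z = 0"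
    using z B_swap[of z e] B_eq_0_swap[of z] by (auto simp: perp_def)
  let ?W = "vec.span (insert e W)"
  have spanW: "vec.span W = W" using W by (simp add: vec.span_eq_iff)
  have coord: "v - B v z *s e \<in> W" if v: "v \<in> ?W" for v
  proof -
    obtain k where k: "v - k *s e \<in> W" using v by (auto simp: vec.span_insert spanW)
    then have "B (v - k *s e) z = 0" by (rule z')
    then have "B v z = k" using z by (simp add: B_simps)
    then show ?thesis using k by simp
  qed
  have inW: "e \<in> ?W" "\<And>w. w \<in> W \<Longrightarrow> w \<in> ?W" by (auto intro: vec.span_base)
  define \<Phi> where "\<Phi> = (\<lambda>(g, w, c) u. g u + hyperbolic e w c u)"
  define \<Psi> where "\<Psi> f = (let c = B (f z) z; w = f z - c *s e in
      ((\<lambda>u. f u - hyperbolic e w c u), w, c))" for f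
  have hz: "hyperbolic e w c z = w + c *s e" if "w \<in> W" for w c
    using that z' by (simp add: hyperbolic_def)
  have "bij_betw \<Phi> (self_adjoint_into W \<times> W \<times> fixed_field) (self_adjoint_into ?W)"
  proof (rule bij_betw_byWitness[where f' = \<Psi>])
    show "\<forall>a\<in>self_adjoint_into W \<times> W \<times> fixed_field. \<Psi> (\<Phi> a) = a"
    proof
      fix a assume "a \<in> self_adjoint_into W \<times> W \<times> fixed_field"
      then obtain g w c where a: "a = (g, w, c)" "g \<in> self_adjoint_into W" "w \<in> W" by auto
      have "\<Phi> a z = w + c *s e"
        using self_adjoint_into_kills_perp[OF a(2) z(1)] hz[OF a(3)] by (simp add: \<Phi>_def a(1))
      moreover from this have "B (\<Phi> a z) z = c" using z z'(3)[OF a(3)] by (simp add: B_simps)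
      ultimately show "\<Psi> (\<Phi> a) = a" by (simp add: \<Psi>_def Let_def) (simp add: \<Phi>_def a(1))
    qed
    show "\<forall>f\<in>self_adjoint_into ?W. \<Phi> (\<Psi> f) = f"
      by (simp add: \<Phi>_def \<Psi>_def Let_def)
    show "\<Phi> ` (self_adjoint_into W \<times> W \<times> fixed_field) \<subseteq> self_adjoint_into ?W"
    proof (rule image_subsetI)
      fix a assume "a \<in> self_adjoint_into W \<times> W \<times> fixed_field"
      then obtain g w c where a: "a = (g, w, c)" "g \<in> self_adjoint_into W" "w \<in> W" "c \<in> fixed_field"
        by auto
      have "\<Phi> a u \<in> ?W" for u
        using a inW unfolding \<Phi>_def a(1) hyperbolic_def
        by (auto simp: self_adjoint_into_def intro!: vec.span_add vec.span_scale)
      moreover have "\<Phi> a \<in> self_adjoint"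
        using a self_adjoint_hyperbolic[OF a(4)] unfolding \<Phi>_def a(1)
        by (auto simp: self_adjoint_into_def intro!: self_adjoint_plus)
      ultimately show "\<Phi> a \<in> self_adjoint_into ?W" by (auto simp: self_adjoint_into_def)
    qed
    show "\<Psi> ` self_adjoint_into ?W \<subseteq> self_adjoint_into W \<times> W \<times> fixed_field"
    proof (rule image_subsetI)
      fix f assume f: "f \<in> self_adjoint_into ?W"
      then have sa: "f \<in> self_adjoint" "\<And>u. f u \<in> ?W" by (auto simp: self_adjoint_into_def)
      define c where "c = B (f z) z"
      define w where "w = f z - c *s e"
      define g where "g u = f u - hyperbolic e w c u" for u
      have c: "c \<in> fixed_field"
        using self_adjointD[OF sa(1), of z z] B_swap[of "f z" z] by (simp add: c_def fixed_field_def)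
      have w: "w \<in> W" unfolding w_def c_def by (rule coord) (rule sa)
      have g: "g \<in> self_adjoint"
        unfolding g_def using sa(1) self_adjoint_hyperbolic[OF c] by (rule self_adjoint_minus)
      have gz: "g z = 0" unfolding g_def hz[OF w] by (simp add: w_def)
      have "g u \<in> W" for u
      proof -
        have "g u \<in> ?W" unfolding g_def hyperbolic_def
          using sa(2) w inW by (auto intro!: vec.span_diff vec.span_add vec.span_scale)
        moreover have "B (g u) z = 0" using self_adjointD[OF g, of u z] gz by simp
        ultimately show ?thesis using coord[of "g u"] by simp
      qed
      then have "g \<in> self_adjoint_into W" using g by (auto simp: self_adjoint_into_def)
      moreover have "\<Psi> f = (g, w, c)"
        unfolding \<Psi>_def Let_def c_def[symmetric] w_def[symmetric] by (simp add: g_def[abs_def])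
      ultimately show "\<Psi> f \<in> self_adjoint_into W \<times> W \<times> fixed_field" using w c by simp
    qed
  qed
  from bij_betw_same_card[OF this] show ?thesis
    by (simp add: card_cartesian_product card_fixed_field)
qed

lemma card_self_adjoint_into:
  assumes "vec.subspace W"
  shows "card (self_adjoint_into W) = q ^ (vec.dim W * vec.dim W)"
proof -
  obtain xs where xs: "indep_list xs" "vec.span (set xs) = W" "length xs = vec.dim W"
    using subspace_obtains_indep_list[OF assms] by blast
  have "indep_list xs \<Longrightarrow> card (self_adjoint_into (vec.span (set xs))) = q ^ (length xs * length xs)"
    for xs :: "('a^'n) list"
  proof (induction xs)
    case Nil
    have "self_adjoint_into {0} = {\<lambda>_. 0}"
      by (auto simp: self_adjoint_into_def self_adjoint_def fun_eq_iff image_subset_iff)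
    then show ?case by simp
  next
    case (Cons x xs)
    have "vec.span (insert x (set xs)) = vec.span (insert x (vec.span (set xs)))"
      by (simp add: vec.span_insert vec.span_span)
    then have "card (self_adjoint_into (vec.span (set (x # xs)))) =
        card (self_adjoint_into (vec.span (set xs))) * (card (vec.span (set xs)) * q)"
      using Cons.prems by (simp add: card_self_adjoint_into_step)
    also have "\<dots> = q ^ (length xs * length xs) * (q ^ (2 * length xs) * q)"
      using Cons card_span_indep_list[of xs] by (simp add: card_field power_mult)
    also have "\<dots> = q ^ (length (x # xs) * length (x # xs))"
      unfolding power_add[symmetric] power_Suc2[symmetric]
      by (rule arg_cong[where f = "\<lambda>i. q ^ i"]) simp
    finally show ?case .
  qed
  then show ?thesis using xs by metis
qed

section \<open>The rank distribution of self-adjoint maps\<close>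

lemma sum_self_adjoint_into:
  fixes h :: "('a^'n) set \<Rightarrow> real"
  assumes "vec.subspace W"
  shows "(\<Sum>f\<in>self_adjoint_into W. h (range f)) =
    (\<Sum>J | vec.subspace J \<and> J \<subseteq> W. real (card (self_adjoint_onto J)) * h J)"
proof -
  have "(\<Sum>f\<in>self_adjoint_into W. h (range f)) =
    (\<Sum>J | vec.subspace J \<and> J \<subseteq> W. \<Sum>f | f \<in> self_adjoint_into W \<and> range f = J. h (range f))"
    by (rule sum.group[symmetric]) (auto simp: self_adjoint_into_def subspace_range_self_adjoint)
  also have "\<dots> = (\<Sum>J | vec.subspace J \<and> J \<subseteq> W. \<Sum>f\<in>self_adjoint_onto J. h J)"
    by (intro sum.cong) (auto simp: self_adjoint_into_def self_adjoint_onto_def)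
  finally show ?thesis by simp
qed

text \<open>\<open>real q ^ (r * r) * qpp r\<close> anticipates the number of self-adjoint maps onto
  an r-dimensional subspace, so the product will count the maps of rank r. At this point it is only
  an identity for Gaussian binomials.\<close>

lemma card_grassmannian_times:
  fixes W :: "('a^'n) set"
  assumes W: "vec.subspace W" and r: "r \<le> vec.dim W"
  shows "real (card (grassmannian W r)) * (real q ^ (r * r) * qpp r) =
    real q ^ (vec.dim W * vec.dim W) * corank_weight (- 1 / real q) (vec.dim W) (vec.dim W - r)"
proof -
  define k where "k = vec.dim W"
  obtain d where d: "k = r + d" using r le_Suc_ex unfolding k_def by blast
  define E where "E k = qp k * qpp k" for k
  have E: "E k \<noteq> 0" for k using qp_nz qpp_nz by (simp add: E_def)
  have q: "real q \<noteq> 0" using q_ge_2 by simp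
  define P where "P k = (\<Prod>l<r. real (q ^ 2) ^ k - real (q ^ 2) ^ l)" for k
  have 1: "P k * E d = real q ^ (2 * k * r) * E k"
    using prod_card_diff[OF q_ge_2, of r k] d by (simp add: P_def E_def)
  have 2: "P r = real q ^ (2 * r * r) * E r"
    using prod_card_diff[OF q_ge_2, of r r] by (simp add: P_def E_def)
  have 3: "real (card (grassmannian W r)) * P r = P k"
    using card_grassmannian[OF W, of r] by (simp add: P_def k_def card_field)
  have "real (card (grassmannian W r)) * (real q ^ (2 * r * r) * (E r * E d)) =
      (real (card (grassmannian W r)) * P r) * E d"
    unfolding 2 by (simp only: mult_ac)
  then have card: "real (card (grassmannian W r)) * (real q ^ (2 * r * r) * (E r * E d)) =
      real q ^ (2 * k * r) * E k"
    unfolding 3 1 .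
  have "2 * k * r + d * d = k * k + r * r" by (simp add: d algebra_simps)
  then have "real q ^ (2 * k * r + d * d) = real q ^ (k * k + r * r)" by (simp only:)
  then have qq: "real q ^ (2 * k * r) * real q ^ (d * d) = real q ^ (k * k) * real q ^ (r * r)"
    by (simp only: power_add)
  have "k - d = r" "d \<le> k" using d by simp_all
  then have "corank_weight (- 1 / real q) k d = E k / (real q ^ (d * d) * (E d * qp r))"
    by (simp add: corank_weight_def E_def power_divide)
  then have cw: "E k = corank_weight (- 1 / real q) k d * (real q ^ (d * d) * (E d * qp r))"
    using E[of d] q qp_nz[of r] by simp
  have q2: "real q ^ (2 * r * r) = real q ^ (r * r) * real q ^ (r * r)"
    by (simp only: mult_2 distrib_right power_add)
  have "real (card (grassmannian W r)) * (real q ^ (r * r) * qpp r) *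
      (real q ^ (r * r) * real q ^ (d * d) * (E d * qp r)) =
      real (card (grassmannian W r)) * (real q ^ (2 * r * r) * (E r * E d)) * real q ^ (d * d)"
    unfolding q2 E_def[of r] by (simp only: mult_ac)
  also have "\<dots> = real q ^ (2 * k * r) * real q ^ (d * d) * E k"
    unfolding card by (simp only: mult_ac)
  also have "\<dots> = real q ^ (k * k) * corank_weight (- 1 / real q) k d *
      (real q ^ (r * r) * real q ^ (d * d) * (E d * qp r))"
    unfolding qq cw by (simp only: mult_ac)
  finally have "real (card (grassmannian W r)) * (real q ^ (r * r) * qpp r) =
      real q ^ (k * k) * corank_weight (- 1 / real q) k d"
    using q E qp_nz by simp
  then show ?thesis using d by (simp add: k_def)
qed

text \<open>The exponent s lets the identity serve twice: s = 0 yields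
  \<open>card_self_adjoint_onto\<close>, and general s then gives the sum over all self-adjoint
  maps.\<close>

lemma sum_grassmannian:
  fixes W :: "('a^'n) set"
  assumes W: "vec.subspace W"
  shows "(\<Sum>J | vec.subspace J \<and> J \<subseteq> W.
      real q ^ (vec.dim J * vec.dim J) * qpp (vec.dim J) * real q ^ (2 * vec.dim J * s)) =
    real q ^ (vec.dim W * vec.dim W) * real q ^ (2 * vec.dim W * s) *
      corank_sum (- 1 / real q) (vec.dim W) ((- 1 / real q) ^ (2 * s))"
proof -
  define k where "k = vec.dim W"
  have q: "real q \<noteq> 0" using q_ge_2 by simp
  have "(\<Sum>J | vec.subspace J \<and> J \<subseteq> W.
      real q ^ (vec.dim J * vec.dim J) * qpp (vec.dim J) * real q ^ (2 * vec.dim J * s)) =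
    (\<Sum>r\<le>k. real (card (grassmannian W r)) * (real q ^ (r * r) * qpp r * real q ^ (2 * r * s)))"
    using sum_over_subspaces[OF W, of "\<lambda>r. real q ^ (r * r) * qpp r * real q ^ (2 * r * s)"]
    by (simp add: k_def)
  also have "\<dots> = (\<Sum>r\<le>k. real q ^ (k * k) * corank_weight (- 1 / real q) k (k - r) * real q ^ (2 * r * s))"
    using card_grassmannian_times[OF W] by (intro sum.cong refl) (simp add: k_def mult.assoc)
  also have "\<dots> = (\<Sum>d\<le>k. real q ^ (k * k) * corank_weight (- 1 / real q) k d * real q ^ (2 * (k - d) * s))"
    by (rule sum.reindex_bij_witness[where i = "\<lambda>d. k - d" and j = "\<lambda>d. k - d"]) auto
  also have "\<dots> = (\<Sum>d\<le>k. real q ^ (k * k) * real q ^ (2 * k * s) *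
      (corank_weight (- 1 / real q) k d * ((- 1 / real q) ^ (2 * s)) ^ d))"
  proof (intro sum.cong refl)
    fix d assume "d \<in> {..k}"
    then have "2 * k * s = 2 * (k - d) * s + 2 * s * d" by (simp add: algebra_simps flip: distrib_left)
    then have "real q ^ (2 * k * s) = real q ^ (2 * (k - d) * s) * real q ^ (2 * s * d)"
      by (simp only: power_add)
    \<comment> \<open>The even exponent removes the sign of -1/q.\<close>
    moreover have "((- 1 / real q) ^ (2 * s)) ^ d = 1 / real q ^ (2 * s * d)"
      by (simp add: power_divide flip: power_mult)
    ultimately show "real q ^ (k * k) * corank_weight (- 1 / real q) k d * real q ^ (2 * (k - d) * s) =
        real q ^ (k * k) * real q ^ (2 * k * s) *
      (corank_weight (- 1 / real q) k d * ((- 1 / real q) ^ (2 * s)) ^ d)"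
      using q by simp
  qed
  finally show ?thesis by (simp add: corank_sum_def sum_distrib_left k_def)
qed

text \<open>Summed over all subspaces J of W, the true and the claimed numbers agree: both totals
  are q^(k*k), by \<open>card_self_adjoint_into\<close> and \<open>corank_sum_one\<close>. Proper J
  agree by induction, which leaves J = W.\<close>

lemma card_self_adjoint_onto:
  assumes "vec.subspace W"
  shows "real (card (self_adjoint_onto W)) = real q ^ (vec.dim W * vec.dim W) * qpp (vec.dim W)"
  using assms
proof (induction "vec.dim W" arbitrary: W rule: less_induct)
  case less
  let ?S = "{J. vec.subspace J \<and> J \<subseteq> W}"
  let ?g = "\<lambda>J. real q ^ (vec.dim J * vec.dim J) * qpp (vec.dim J)"
  have "(\<Sum>J\<in>?S. real (card (self_adjoint_onto J))) = real (card (self_adjoint_into W))"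
    using sum_self_adjoint_into[OF less.prems, of "\<lambda>_. 1"] by simp
  also have "\<dots> = (\<Sum>J\<in>?S. ?g J)"
  proof -
    have s: "corank_sum (- 1 / real q) (vec.dim W) ((- 1 / real q) ^ (2 * 0)) = 1"
      by (simp only: mult_0_right power_0 corank_sum_one)
    show ?thesis
      using sum_grassmannian[OF less.prems, of 0, unfolded s] card_self_adjoint_into[OF less.prems]
      by simp
  qed
  finally have eq: "(\<Sum>J\<in>?S. real (card (self_adjoint_onto J))) = (\<Sum>J\<in>?S. ?g J)" .
  have "(\<Sum>J\<in>?S - {W}. real (card (self_adjoint_onto J))) = (\<Sum>J\<in>?S - {W}. ?g J)"
    using less by (intro sum.cong refl less.hyps) (auto intro: dim_subspace_less)
  then show ?case
    using eq less.prems by (simp add: sum.remove[of ?S W])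
qed

lemma sum_card_range_self_adjoint:
  assumes W: "vec.subspace W"
  shows "(\<Sum>f\<in>self_adjoint_into W. real (card (range f)) ^ s) =
    real q ^ (vec.dim W * vec.dim W) * real q ^ (2 * vec.dim W * s) *
      corank_sum (- 1 / real q) (vec.dim W) ((- 1 / real q) ^ (2 * s))"
proof -
  have "(\<Sum>f\<in>self_adjoint_into W. real (card (range f)) ^ s) =
    (\<Sum>J | vec.subspace J \<and> J \<subseteq> W. real (card (self_adjoint_onto J)) * real (card J) ^ s)"
    by (rule sum_self_adjoint_into[OF W])
  also have "\<dots> = (\<Sum>J | vec.subspace J \<and> J \<subseteq> W.
      real q ^ (vec.dim J * vec.dim J) * qpp (vec.dim J) * real q ^ (2 * vec.dim J * s))"
    by (intro sum.cong refl)
      (simp add: card_self_adjoint_onto card_subspace card_field flip: power_mult)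
  finally show ?thesis by (simp only: sum_grassmannian[OF W])
qed

end

section \<open>The Fitting decomposition\<close>

text \<open>The powers of f are eventually periodic. For self-adjoint x such a power is the Fitting
  projection; N > 0 makes it factor through x.\<close>

lemma exists_idempotent_power:
  fixes f :: "'b::finite \<Rightarrow> 'b"
  shows "\<exists>N>0. f ^^ N \<circ> f ^^ N = f ^^ N"
proof -
  have "\<not> inj (\<lambda>n. f ^^ n)"
    using finite_imageD[of "\<lambda>n. f ^^ n" UNIV] by auto
  then obtain i j where ij: "f ^^ i = f ^^ j" "i < j"
    by (metis injI linorder_neqE_nat)
  define d where "d = j - i"
  have step: "f ^^ (n + d) = f ^^ n" if "n \<ge> i" for n
  proof -
    have "f ^^ (n + d) = f ^^ (n - i) \<circ> f ^^ j"
      using that ij(2) by (simp add: d_def flip: funpow_add)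
    also have "\<dots> = f ^^ n" using that by (simp flip: ij(1) funpow_add)
    finally show ?thesis .
  qed
  have steps: "f ^^ (n + d * k) = f ^^ n" if "n \<ge> i" for n k
  proof (induction k)
    case (Suc k)
    have "f ^^ (n + d * Suc k) = f ^^ ((n + d * k) + d)" by (simp add: algebra_simps)
    also have "\<dots> = f ^^ (n + d * k)" using that by (intro step) simp
    finally show ?case using Suc by simp
  qed simp
  \<comment> \<open>A positive multiple of the period d that lies beyond the preperiod i.\<close>
  define N where "N = d * Suc i"
  have "d > 0" using ij(2) by (simp add: d_def)
  then have "1 * Suc i \<le> N" unfolding N_def by (intro mult_le_mono1) simp
  then have "N > 0" "N \<ge> i" by simp_all
  moreover have "f ^^ N \<circ> f ^^ N = f ^^ N"
    using steps[of N "Suc i"] \<open>N \<ge> i\<close> by (simp add: N_def flip: funpow_add)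
  ultimately show ?thesis by blast
qed

context hermitian_space
begin

definition nilpotent_into :: "('a^'n) set \<Rightarrow> ('a^'n \<Rightarrow> 'a^'n) set" where
  "nilpotent_into W = {f \<in> self_adjoint_into W. \<exists>N. f ^^ N = (\<lambda>_. 0)}"

lemma self_adjoint_funpow: "f \<in> self_adjoint \<Longrightarrow> f ^^ n \<in> self_adjoint"
  by (induction n) (simp_all add: self_adjoint_def funpow_swap1)

lemma nilpotent_funpow_ge:
  assumes "f \<in> self_adjoint" "f ^^ N = (\<lambda>_. 0)" "n \<ge> N"
  shows "(f ^^ n) u = 0"
proof -
  have "f ^^ n = f ^^ (n - N) \<circ> f ^^ N" using assms(3) by (simp flip: funpow_add)
  then show ?thesis using assms self_adjoint_zero[OF self_adjoint_funpow] by simp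
qed

lemma nondeg_decompose_sum:
  assumes "nondeg I"
  obtains a b where "u = a + b" "a \<in> I" "b \<in> perp I"
proof -
  obtain a where "a \<in> I" "u - a \<in> perp I" using nondeg_decompose[OF assms] by blast
  then show ?thesis using that[of a "u - a"] by simp
qed

lemma nondeg_sum_unique:
  assumes "nondeg I" "a + b = a' + b'" "a \<in> I" "a' \<in> I" "b \<in> perp I" "b' \<in> perp I"
  shows "a = a'" "b = b'"
proof -
  have "a - a' = b' - b" using assms(2) by (simp add: algebra_simps)
  moreover have "a - a' \<in> I" using assms nondeg_subspace by (blast intro: vec.subspace_diff)
  moreover have "b' - b \<in> perp I" using assms subspace_perp by (blast intro: vec.subspace_diff)
  ultimately have "a - a' = 0" using assms(1) by (auto simp: nondeg_def)
  then show "a = a'" by simp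
  with assms(2) show "b = b'" by simp
qed

end

text \<open>The two summands of the Fitting decomposition relative to a non-degenerate subspace \<open>I\<close>:
  \<open>f\<close> is invertible on \<open>I\<close> and \<open>g\<close> is nilpotent on its complement.\<close>

locale fitting_pair = hermitian_space p q B
  for p q :: nat and B :: "('a::{field,finite})^'n \<Rightarrow> 'a^'n \<Rightarrow> 'a" +
  fixes I :: "('a^'n) set" and f g :: "'a^'n \<Rightarrow> 'a^'n"
  assumes nondeg_I: "nondeg I" and f: "f \<in> self_adjoint_onto I"
    and g: "g \<in> nilpotent_into (perp I)"
begin

lemma f_sa: "f \<in> self_adjoint" and range_f: "range f = I"
  using f by (auto simp: self_adjoint_onto_def)

lemma g_sa: "g \<in> self_adjoint" and range_g: "range g \<subseteq> perp I"
  using g by (auto simp: nilpotent_into_def self_adjoint_into_def)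

lemma f_perp: "b \<in> perp I \<Longrightarrow> f b = 0"
  using self_adjoint_eq_0_iff[OF f_sa] range_f by simp

lemma g_I:
  assumes "a \<in> I"
  shows "g a = 0"
proof -
  have "B a (g v) = 0" for v using assms range_g B_eq_0_swap[of a "g v"] by (auto simp: perp_def)
  then have "a \<in> perp (range g)" by (auto simp: perp_def)
  then show ?thesis using self_adjoint_eq_0_iff[OF g_sa] by simp
qed

lemma f_in_I: "f u \<in> I"
  using range_f by blast

lemma g_in_perp: "g u \<in> perp I"
  using range_g by blast

lemma f_onto_from_I:
  assumes "w \<in> I"
  obtains a where "a \<in> I" "f a = w"
proof -
  obtain u where u: "w = f u" using assms range_f by blast
  obtain a b where ab: "u = a + b" "a \<in> I" "b \<in> perp I"
    using nondeg_decompose_sum[OF nondeg_I] by blast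
  then have "f a = w" by (simp add: u self_adjoint_add[OF f_sa] f_perp)
  then show ?thesis using that ab by blast
qed

definition total where "total u = f u + g u"

lemma total_sum:
  assumes "a \<in> I" "b \<in> perp I"
  shows "total (a + b) = f a + g b"
  using assms by (simp add: total_def self_adjoint_add[OF f_sa] self_adjoint_add[OF g_sa] f_perp g_I)

lemma total_funpow_sum:
  assumes "a \<in> I" "b \<in> perp I"
  shows "(total ^^ n) (a + b) = (f ^^ n) a + (g ^^ n) b \<and> (f ^^ n) a \<in> I \<and> (g ^^ n) b \<in> perp I"
  by (induction n) (use assms in \<open>auto simp: total_sum f_in_I g_in_perp\<close>)

lemma funpow_f_onto_from_I: "w \<in> I \<Longrightarrow> \<exists>a\<in>I. (f ^^ n) a = w"
proof (induction n arbitrary: w)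
  case (Suc n)
  obtain a where "a \<in> I" "f a = w" using f_onto_from_I[OF Suc.prems] by blast
  then show ?case using Suc.IH[of a] by auto
qed auto

text \<open>The sum recovers I as its eventual range, the key to uniqueness of the
  decomposition.\<close>

lemma range_total_funpow: "\<exists>N. \<forall>n\<ge>N. range (total ^^ n) = I"
proof -
  obtain N where N: "g ^^ N = (\<lambda>_. 0)" using g by (auto simp: nilpotent_into_def)
  have "range (total ^^ n) = I" if "n \<ge> N" for n
  proof (intro equalityI subsetI)
    fix w assume "w \<in> range (total ^^ n)"
    then obtain u where u: "w = (total ^^ n) u" by blast
    obtain a b where ab: "u = a + b" "a \<in> I" "b \<in> perp I"
      using nondeg_decompose_sum[OF nondeg_I] by blast
    then show "w \<in> I"
      using total_funpow_sum[OF ab(2,3), of n] nilpotent_funpow_ge[OF g_sa N that, of b] u by simp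
  next
    fix w assume "w \<in> I"
    then obtain a where a: "a \<in> I" "(f ^^ n) a = w" using funpow_f_onto_from_I by blast
    have "0 \<in> perp I" by (simp add: perp_def)
    then have "(total ^^ n) (a + 0) = w"
      using total_funpow_sum[OF a(1), of 0 n] nilpotent_funpow_ge[OF g_sa N that, of 0] a(2) by simp
    then show "w \<in> range (total ^^ n)" by (metis rangeI)
  qed
  then show ?thesis by blast
qed

text \<open>Given I, the sum also recovers f: it agrees with the sum on I and vanishes on the
  complement.\<close>

lemma f_eq_total:
  assumes "a \<in> I" "b \<in> perp I"
  shows "f (a + b) = total a"
  using assms by (simp add: self_adjoint_add[OF f_sa] f_perp total_def g_I)

text \<open>This multiplicativity is what makes the sum of |range x|^s split over the
  decomposition.\<close>

lemma card_range_total: "card (range total) = card I * card (range g)"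
proof -
  have "bij_betw (\<lambda>(a, b). a + b) (I \<times> range g) (range total)"
    unfolding bij_betw_def
  proof (intro conjI inj_onI equalityI subsetI)
    fix x y assume "x \<in> I \<times> range g" "y \<in> I \<times> range g" "(\<lambda>(a, b). a + b) x = (\<lambda>(a, b). a + b) y"
    then show "x = y"
      using nondeg_sum_unique[OF nondeg_I, of "fst x" "snd x" "fst y" "snd y"] g_in_perp
      by (auto simp: prod_eq_iff split_beta)
  next
    fix w assume "w \<in> range total"
    then obtain u where "w = f u + g u" by (auto simp: total_def)
    then show "w \<in> (\<lambda>(a, b). a + b) ` (I \<times> range g)"
      by (intro image_eqI[of _ _ "(f u, g u)"]) (auto simp: f_in_I)
  next
    fix w assume "w \<in> (\<lambda>(a, b). a + b) ` (I \<times> range g)"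
    then obtain c v where w: "w = c + g v" "c \<in> I" by auto
    obtain a where a: "a \<in> I" "f a = c" using f_onto_from_I[OF w(2)] by blast
    obtain a' b where ab: "v = a' + b" "a' \<in> I" "b \<in> perp I"
      using nondeg_decompose_sum[OF nondeg_I] by blast
    then have "g v = g b" by (simp add: self_adjoint_add[OF g_sa] g_I)
    then have "total (a + b) = w" using total_sum[OF a(1) ab(3)] a w by simp
    then show "w \<in> range total" by blast
  qed
  from bij_betw_same_card[OF this] show ?thesis by (simp add: card_cartesian_product)
qed

end

context hermitian_space
begin

text \<open>The idempotent power \<open>\<pi>\<close> of x is self-adjoint and commutes with x, so
  \<open>f = x \<circ> \<pi>\<close> and g = x - f are self-adjoint. The kernel of
  \<open>\<pi>\<close> is the orthogonal complement of its range I, and a projection meets its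
  kernel in 0, so I is non-degenerate.\<close>

lemma exists_fitting_pair:
  assumes x: "x \<in> self_adjoint_into W" and W: "vec.subspace W"
  shows "\<exists>I f g. I \<subseteq> W \<and> fitting_pair p q B I f g \<and> range g \<subseteq> W \<and> (\<forall>u. x u = f u + g u)"
proof -
  have sa: "x \<in> self_adjoint" and xW: "\<And>u. x u \<in> W" using x by (auto simp: self_adjoint_into_def)
  obtain N where N: "N > 0" "x ^^ N \<circ> x ^^ N = x ^^ N" using exists_idempotent_power by blast
  define \<pi> where "\<pi> = x ^^ N"
  have idem: "\<pi> (\<pi> u) = \<pi> u" for u using N(2) unfolding \<pi>_def by (metis comp_apply)
  have \<pi>: "\<pi> \<in> self_adjoint" unfolding \<pi>_def by (rule self_adjoint_funpow[OF sa])
  have comm: "\<pi> (x u) = x (\<pi> u)" for u unfolding \<pi>_def by (simp add: funpow_swap1)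
  have comm_funpow: "\<pi> ((x ^^ n) u) = (x ^^ n) (\<pi> u)" for n u
    by (induction n) (simp_all add: comm)
  have factor: "\<exists>v. \<pi> u = x v" for u
    using N(1) unfolding \<pi>_def by (cases N) auto
  define f where "f u = x (\<pi> u)" for u
  define g where "g u = x (u - \<pi> u)" for u
  define I where "I = range \<pi>"
  have sub: "vec.subspace I" unfolding I_def by (rule subspace_range_self_adjoint[OF \<pi>])
  have perp_I: "u \<in> perp I \<longleftrightarrow> \<pi> u = 0" for u
    unfolding I_def using self_adjoint_eq_0_iff[OF \<pi>] by simp
  have nd: "nondeg I" unfolding nondeg_def
  proof (intro conjI sub subsetI)
    fix u assume u: "u \<in> I \<inter> perp I"
    then obtain v where "u = \<pi> v" by (auto simp: I_def)
    then have "\<pi> u = u" by (simp add: idem)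
    then show "u \<in> {0}" using u perp_I by simp
  qed
  have IW: "I \<subseteq> W"
  proof
    fix w assume "w \<in> I"
    then obtain u where "w = \<pi> u" by (auto simp: I_def)
    moreover obtain v where "\<pi> u = x v" using factor by blast
    ultimately show "w \<in> W" using xW by simp
  qed
  have f_sa: "f \<in> self_adjoint"
    using self_adjointD[OF sa] self_adjointD[OF \<pi>] comm by (simp add: self_adjoint_def f_def)
  have g_alt: "g = (\<lambda>u. x u - f u)"
    by (rule ext) (simp add: g_def f_def self_adjoint_diff[OF sa])
  have g_sa: "g \<in> self_adjoint" unfolding g_alt by (rule self_adjoint_minus[OF sa f_sa])
  have range_f: "range f = I"
  proof (intro equalityI subsetI)
    fix w assume "w \<in> range f"
    then obtain u where "w = \<pi> (x u)" by (auto simp: f_def comm)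
    then show "w \<in> I" by (auto simp: I_def)
  next
    fix w assume "w \<in> I"
    then obtain u where u: "w = \<pi> u" by (auto simp: I_def)
    obtain v where v: "\<pi> u = x v" using factor by blast
    have "f v = \<pi> (\<pi> u)" by (simp add: f_def v comm)
    then have "f v = w" by (simp add: u idem)
    then show "w \<in> range f" by blast
  qed
  \<comment> \<open>Stated from exponent 1 on, since \<open>g ^^ 0\<close> is the identity and not
    \<open>u - \<pi> u\<close>. At exponent N the right side is
    \<open>\<pi> (u - \<pi> u) = 0\<close>.\<close>
  have g_pow: "(g ^^ Suc n) u = (x ^^ Suc n) (u - \<pi> u)" for n u
  proof (induction n)
    case (Suc n)
    have "\<pi> ((x ^^ Suc n) (u - \<pi> u)) = (x ^^ Suc n) (\<pi> (u - \<pi> u))"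
      by (rule comm_funpow)
    also have "\<dots> = 0"
      using self_adjoint_zero[OF self_adjoint_funpow[OF sa]]
      by (simp only: self_adjoint_diff[OF \<pi>] idem diff_self)
    finally have "g ((x ^^ Suc n) (u - \<pi> u)) = x ((x ^^ Suc n) (u - \<pi> u))"
      by (simp only: g_def diff_zero)
    then show ?case using Suc.IH by simp
  qed (simp add: g_def)
  have "(g ^^ N) u = 0" for u
  proof -
    have "(g ^^ N) u = \<pi> (u - \<pi> u)" using g_pow[of "N - 1" u] N(1) by (simp add: \<pi>_def)
    then show ?thesis by (simp add: self_adjoint_diff[OF \<pi>] idem)
  qed
  then have g_nil: "g ^^ N = (\<lambda>_. 0)" by (simp add: fun_eq_iff)
  have "g u \<in> perp I" for u
    unfolding perp_I by (simp add: g_def comm self_adjoint_diff[OF \<pi>] idem self_adjoint_zero[OF sa])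
  then have "g \<in> nilpotent_into (perp I)"
    using g_sa g_nil by (auto simp: nilpotent_into_def self_adjoint_into_def)
  then have "fitting_pair p q B I f g"
    using nd f_sa range_f by unfold_locales (auto simp: self_adjoint_onto_def)
  moreover have "range g \<subseteq> W" using xW by (auto simp: g_def)
  moreover have "x u = f u + g u" for u by (simp add: g_alt)
  ultimately show ?thesis using IW by blast
qed

lemma bij_betw_fitting:
  assumes W: "vec.subspace W"
  shows "bij_betw (\<lambda>(I, f, g) u. f u + g u)
    (SIGMA I:{I. nondeg I \<and> I \<subseteq> W}. self_adjoint_onto I \<times> nilpotent_into (W \<inter> perp I))
    (self_adjoint_into W)"
proof -
  have pair: "fitting_pair p q B I f g"
    if "nondeg I" "f \<in> self_adjoint_onto I" "g \<in> nilpotent_into (W \<inter> perp I)" for I f g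
    using that by unfold_locales (auto simp: nilpotent_into_def self_adjoint_into_def)
  show ?thesis unfolding bij_betw_def
  proof (intro conjI inj_onI equalityI subsetI)
    fix t t' assume t: "t \<in> (SIGMA I:{I. nondeg I \<and> I \<subseteq> W}. self_adjoint_onto I \<times> nilpotent_into (W \<inter> perp I))"
      "t' \<in> (SIGMA I:{I. nondeg I \<and> I \<subseteq> W}. self_adjoint_onto I \<times> nilpotent_into (W \<inter> perp I))"
      and eq: "(\<lambda>(I, f, g) u. f u + g u) t = (\<lambda>(I, f, g) u. f u + g u) t'"
    obtain I f g I' f' g' where tt: "t = (I, f, g)" "t' = (I', f', g')" by (cases t, cases t')
    interpret L: fitting_pair p q B I f g using t tt by (intro pair) auto
    interpret R: fitting_pair p q B I' f' g' using t tt by (intro pair) auto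
    have tot: "L.total = R.total"
      using eq tt by (simp add: L.total_def[abs_def] R.total_def[abs_def])
    obtain N where N: "\<forall>n\<ge>N. range (L.total ^^ n) = I" using L.range_total_funpow by blast
    obtain M where M: "\<forall>n\<ge>M. range (R.total ^^ n) = I'" using R.range_total_funpow by blast
    have I: "I = I'" using N[rule_format, of "max N M"] M[rule_format, of "max N M"] tot by simp
    have f: "f u = f' u" for u
    proof -
      obtain a b where ab: "u = a + b" "a \<in> I" "b \<in> perp I"
        using nondeg_decompose_sum[OF L.nondeg_I] by blast
      then show ?thesis using L.f_eq_total[OF ab(2,3)] R.f_eq_total[of a b] I tot by simp
    qed
    moreover have "g u = g' u" for u
      using f[of u] fun_cong[OF tot, of u] by (simp add: L.total_def R.total_def)
    ultimately show "t = t'" using tt I by auto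
  next
    fix x assume "x \<in> (\<lambda>(I, f, g) u. f u + g u) `
      (SIGMA I:{I. nondeg I \<and> I \<subseteq> W}. self_adjoint_onto I \<times> nilpotent_into (W \<inter> perp I))"
    then obtain I f g where x: "x = (\<lambda>u. f u + g u)" "I \<subseteq> W" "f \<in> self_adjoint_onto I"
      "g \<in> nilpotent_into (W \<inter> perp I)" by auto
    then have "f u + g u \<in> W" for u
      using W by (intro vec.subspace_add)
        (auto simp: self_adjoint_onto_def nilpotent_into_def self_adjoint_into_def)
    moreover have "x \<in> self_adjoint" unfolding x(1)
      using x by (intro self_adjoint_plus)
        (auto simp: self_adjoint_onto_def nilpotent_into_def self_adjoint_into_def)
    ultimately show "x \<in> self_adjoint_into W" by (auto simp: self_adjoint_into_def x(1))
  next
    fix x assume "x \<in> self_adjoint_into W"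
    from exists_fitting_pair[OF this W] obtain I f g where
      fg: "I \<subseteq> W" "fitting_pair p q B I f g" "range g \<subseteq> W" "\<forall>u. x u = f u + g u" by blast
    interpret fitting_pair p q B I f g by (rule fg)
    have "g \<in> nilpotent_into (W \<inter> perp I)"
      using g fg(3) by (auto simp: nilpotent_into_def self_adjoint_into_def)
    then show "x \<in> (\<lambda>(I, f, g) u. f u + g u) `
      (SIGMA I:{I. nondeg I \<and> I \<subseteq> W}. self_adjoint_onto I \<times> nilpotent_into (W \<inter> perp I))"
      using fg nondeg_I f by (intro image_eqI[of _ _ "(I, f, g)"]) (auto simp: fun_eq_iff)
  qed
qed

section \<open>Solving for the nilpotent sums\<close>

definition nilpotent_weight :: "nat \<Rightarrow> ('a^'n) set \<Rightarrow> real" where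
  "nilpotent_weight s W = (\<Sum>g\<in>nilpotent_into W. real (card (range g)) ^ s)"

lemma fitting_sum:
  assumes W: "vec.subspace W"
  shows "(\<Sum>x\<in>self_adjoint_into W. real (card (range x)) ^ s) =
    (\<Sum>I | nondeg I \<and> I \<subseteq> W.
      real (card (self_adjoint_onto I)) * real (card I) ^ s * nilpotent_weight s (W \<inter> perp I))"
proof -
  let ?A = "{I. nondeg I \<and> I \<subseteq> W}"
  have "(\<Sum>x\<in>self_adjoint_into W. real (card (range x)) ^ s) =
    (\<Sum>t\<in>(SIGMA I:?A. self_adjoint_onto I \<times> nilpotent_into (W \<inter> perp I)).
      real (card (range ((\<lambda>(I, f, g) u. f u + g u) t))) ^ s)"
    by (rule sum.reindex_bij_betw[OF bij_betw_fitting[OF W], symmetric])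
  also have "\<dots> = (\<Sum>(I, f, g)\<in>(SIGMA I:?A. self_adjoint_onto I \<times> nilpotent_into (W \<inter> perp I)).
      real (card I) ^ s * real (card (range g)) ^ s)"
  proof (intro sum.cong refl)
    fix t assume t: "t \<in> (SIGMA I:?A. self_adjoint_onto I \<times> nilpotent_into (W \<inter> perp I))"
    obtain I f g where tt: "t = (I, f, g)" by (cases t)
    interpret fitting_pair p q B I f g
      using t tt by unfold_locales (auto simp: nilpotent_into_def self_adjoint_into_def)
    show "real (card (range ((\<lambda>(I, f, g) u. f u + g u) t))) ^ s =
        (case t of (I, f, g) \<Rightarrow> real (card I) ^ s * real (card (range g)) ^ s)"
      using card_range_total by (simp add: tt total_def[abs_def] power_mult_distrib)
  qed
  also have "\<dots> = (\<Sum>I\<in>?A. \<Sum>(f, g)\<in>self_adjoint_onto I \<times> nilpotent_into (W \<inter> perp I).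
      real (card I) ^ s * real (card (range g)) ^ s)"
    by (subst sum.Sigma) auto
  also have "\<dots> = (\<Sum>I\<in>?A. \<Sum>f\<in>self_adjoint_onto I. \<Sum>g\<in>nilpotent_into (W \<inter> perp I).
      real (card I) ^ s * real (card (range g)) ^ s)"
    by (simp only: sum.cartesian_product)
  also have "\<dots> = (\<Sum>I\<in>?A. real (card (self_adjoint_onto I)) * real (card I) ^ s *
      nilpotent_weight s (W \<inter> perp I))"
    by (simp add: nilpotent_weight_def sum_distrib_left mult.assoc)
  finally show ?thesis .
qed

text \<open>\<open>fitting_sum\<close> and \<open>nilpotent_sum_convolution\<close> say that true
  and predicted values have the same convolution. Complements of nonzero I have smaller dimension
  and are settled by induction, so the term I = {0}, which carries W itself, must agree as
  well.\<close>

lemma nilpotent_weight_eq: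
  assumes "nondeg W"
  shows "nilpotent_weight s W = real q ^ (2 * vec.dim W * s) * unitary_order q (vec.dim W) *
    nilpotent_sum (- 1 / real q) ((- 1 / real q) ^ (2 * s)) (vec.dim W)"
  using assms
proof (induction "vec.dim W" arbitrary: W rule: less_induct)
  case less
  define k where "k = vec.dim W"
  define y where "y = - 1 / real q"
  \<comment> \<open>The predicted summand of \<open>fitting_sum\<close> for an I of dimension
    i.\<close>
  define h where "h i = real q ^ (i * i) * qpp i * real q ^ (2 * i * s) *
    (real q ^ (2 * (k - i) * s) * unitary_order q (k - i) * nilpotent_sum y (y ^ (2 * s)) (k - i))" for i
  let ?A = "{I. nondeg I \<and> I \<subseteq> W}"
  let ?t = "\<lambda>I. real (card (self_adjoint_onto I)) * real (card I) ^ s * nilpotent_weight s (W \<inter> perp I)"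
  have sub: "vec.subspace W" using less.prems by (rule nondeg_subspace)
  have q: "real q \<noteq> 0" using q_ge_2 by simp
  have dimI: "vec.dim I \<le> k" if "I \<in> ?A" for I using that unfolding k_def by (auto intro: vec.dim_subset)
  have pre: "real (card (self_adjoint_onto I)) * real (card I) ^ s =
      real q ^ (vec.dim I * vec.dim I) * qpp (vec.dim I) * real q ^ (2 * vec.dim I * s)" if "I \<in> ?A" for I
    using that nondeg_subspace
    by (simp add: card_self_adjoint_onto card_subspace card_field flip: power_mult)
  have summand: "?t I = h (vec.dim I)" if "I \<in> ?A" "I \<noteq> {0}" for I
  proof -
    have I: "nondeg I" "I \<subseteq> W" using that by auto
    note c = nondeg_complement[OF less.prems I]
    have "vec.dim I \<noteq> 0" using that dim_zero_iff nondeg_subspace by blast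
    then have "vec.dim (W \<inter> perp I) < vec.dim W"
      using dimI[OF that(1)] unfolding c(2) k_def by linarith
    from less.hyps[OF this c(1)] show ?thesis
      unfolding pre[OF that(1)] h_def c(2) by (simp add: k_def y_def)
  qed
  have zero: "{0} \<in> ?A" using nondeg_zero vec.subspace_0[OF sub] by simp
  have "(\<Sum>I\<in>?A. h (vec.dim I)) =
      (\<Sum>r\<le>k. unitary_order q k / (unitary_order q r * unitary_order q (k - r)) * h r)"
    using sum_over_nondeg_subspaces[OF less.prems, of h] by (simp add: k_def)
  also have "\<dots> = (\<Sum>r\<le>k. unitary_order q k * real q ^ (2 * k * s) *
      (qpp r / qp r * nilpotent_sum y (y ^ (2 * s)) (k - r)))"
  proof (intro sum.cong refl)
    fix r assume "r \<in> {..k}"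
    then have "2 * k * s = 2 * r * s + 2 * (k - r) * s" by (simp add: algebra_simps flip: distrib_left)
    then have pw: "real q ^ (2 * k * s) = real q ^ (2 * r * s) * real q ^ (2 * (k - r) * s)"
      by (simp only: power_add)
    have u: "unitary_order q r = real q ^ (r * r) * qp r" by (simp add: unitary_order_def)
    show "unitary_order q k / (unitary_order q r * unitary_order q (k - r)) * h r =
      unitary_order q k * real q ^ (2 * k * s) * (qpp r / qp r * nilpotent_sum y (y ^ (2 * s)) (k - r))"
      unfolding h_def pw u using unitary_order_nz[of "k - r"] q qp_nz[of r] by simp
  qed
  also have "\<dots> = unitary_order q k * real q ^ (2 * k * s) * (corank_sum y k (y ^ (2 * s)) / qp k)"
    unfolding sum_distrib_left[symmetric] y_def nilpotent_sum_convolution ..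
  also have "\<dots> = real q ^ (k * k) * real q ^ (2 * k * s) * corank_sum y k (y ^ (2 * s))"
    using qp_nz[of k] by (simp add: unitary_order_def)
  also have "\<dots> = (\<Sum>I\<in>?A. ?t I)"
    unfolding fitting_sum[OF sub, symmetric] sum_card_range_self_adjoint[OF sub] k_def y_def ..
  finally have "(\<Sum>I\<in>?A. h (vec.dim I)) = (\<Sum>I\<in>?A. ?t I)" .
  moreover have "(\<Sum>I\<in>?A - {{0}}. h (vec.dim I)) = (\<Sum>I\<in>?A - {{0}}. ?t I)"
    using summand by (intro sum.cong) auto
  ultimately have "h (vec.dim ({0} :: ('a^'n) set)) = ?t {0}"
    using zero by (simp add: sum.remove[of ?A "{0}"])
  moreover have "W \<inter> perp {0} = W" by (auto simp: perp_def)
  ultimately show ?case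
    unfolding pre[OF zero] by (simp add: h_def k_def y_def)
qed

end

section \<open>Unipotent isometries and the affine group\<close>

definition linear_map :: "('a::field^'n \<Rightarrow> 'a^'n) \<Rightarrow> bool" where
  "linear_map f \<longleftrightarrow> (\<forall>u v. f (u + v) = f u + f v) \<and> (\<forall>c u. f (c *s u) = c *s f u)"

lemma linear_map_add: "linear_map f \<Longrightarrow> f (u + v) = f u + f v"
  and linear_map_scale: "linear_map f \<Longrightarrow> f (c *s u) = c *s f u"
  by (simp_all add: linear_map_def)

lemma linear_map_zero: "linear_map f \<Longrightarrow> f 0 = 0"
  using linear_map_scale[of f 0 0] by simp

lemma linear_map_minus: "linear_map f \<Longrightarrow> f (- u) = - f u"
  using linear_map_scale[of f "-1" u] by simp

lemma linear_map_diff: "linear_map f \<Longrightarrow> f (u - v) = f u - f v"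
  using linear_map_add[of f u "- v"] by (simp add: linear_map_minus)

lemma linear_map_iff: "linear_map f \<longleftrightarrow> Vector_Spaces.linear (*s) (*s) f"
  by (auto simp: linear_map_def Vector_Spaces.linear_iff vec.vector_space_axioms)

lemma linear_map_funpow: "linear_map f \<Longrightarrow> linear_map (f ^^ n)"
  by (induction n) (simp_all add: linear_map_def)

lemma linear_map_vector_matrix_mult: "linear_map (\<lambda>u. u v* a)"
  by (simp add: linear_map_def vector_matrix_left_distrib scalar_vector_matrix_assoc)

lemma linear_map_inv:
  assumes "linear_map f" "bij f"
  shows "linear_map (inv_into UNIV f)"
proof -
  have s: "f (inv_into UNIV f u) = u" for u using assms(2) by (simp add: bij_is_surj surj_f_inv_f)
  have "inv_into UNIV f (u + v) = inv_into UNIV f u + inv_into UNIV f v" for u v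
    using assms by (intro inv_f_eq bij_is_inj) (simp_all add: linear_map_add s)
  moreover have "inv_into UNIV f (c *s u) = c *s inv_into UNIV f u" for c u
    using assms by (intro inv_f_eq bij_is_inj) (simp_all add: linear_map_scale s)
  ultimately show ?thesis by (simp add: linear_map_def)
qed

section \<open>Nilpotent maps and the Cayley transform\<close>

definition nilpotent_map :: "('a::field^'n \<Rightarrow> 'a^'n) \<Rightarrow> bool" where
  "nilpotent_map f \<longleftrightarrow> linear_map f \<and> (\<exists>N. f ^^ N = (\<lambda>_. 0))"

text \<open>The Moebius transformation L/(d + c L), which fixes 0. Its inverse has the same shape,
  with parameters 1/d and -c/d.\<close>

definition cayley :: "'a::field \<Rightarrow> 'a \<Rightarrow> ('a^'n \<Rightarrow> 'a^'n) \<Rightarrow> 'a^'n \<Rightarrow> 'a^'n" where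
  "cayley d c L = L \<circ> inv_into UNIV (\<lambda>u. d *s u + c *s L u)"

text \<open>A kernel vector satisfies u = (-c/d) L u, hence u = (-c/d)^n L^n u for all n, and
  nilpotency forces u = 0.\<close>

lemma bij_cayley_denominator:
  fixes L :: "'a::{field,finite}^'n \<Rightarrow> 'a^'n"
  assumes L: "nilpotent_map L" and d: "d \<noteq> 0"
  shows "bij (\<lambda>u. d *s u + c *s L u)"
proof -
  let ?T = "\<lambda>u. d *s u + c *s L u"
  have lin: "linear_map L" using L by (simp add: nilpotent_map_def)
  obtain N where N: "L ^^ N = (\<lambda>_. 0)" using L by (auto simp: nilpotent_map_def)
  have "u = 0" if "?T u = 0" for u
  proof -
    have "d *s u = (- c) *s L u" using that by (simp add: eq_neg_iff_add_eq_0)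
    then have "(1 / d) *s (d *s u) = (1 / d) *s ((- c) *s L u)" by (simp only:)
    then have u: "u = (- c / d) *s L u" using d by (simp add: vec.scale_scale del: vec.scale_minus_left)
    have "u = (- c / d) ^ n *s (L ^^ n) u" for n
    proof (induction n)
      case (Suc n)
      have "(L ^^ n) u = (- c / d) *s (L ^^ Suc n) u"
        by (subst u) (simp only: linear_map_scale[OF linear_map_funpow[OF lin]] funpow_swap1 funpow.simps comp_apply)
      then have "(- c / d) ^ n *s (L ^^ n) u = (- c / d) ^ Suc n *s (L ^^ Suc n) u"
        by (simp only: vec.scale_scale power_Suc2)
      then show ?case using Suc.IH by (simp only:)
    qed simp
    from this[of N] show ?thesis by (simp add: N)
  qed
  moreover have "?T (u - v) = ?T u - ?T v" for u v
    unfolding linear_map_diff[OF lin] by (simp add: vec.scale_right_diff_distrib)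
  ultimately have "u = v" if "?T u = ?T v" for u v
    using that by (metis right_minus_eq)
  then have "inj ?T" by (rule injI)
  then show ?thesis by (simp add: bij_def finite_UNIV_inj_surj)
qed

lemma cayley_denominator:
  fixes L :: "'a::{field,finite}^'n \<Rightarrow> 'a^'n"
  assumes L: "nilpotent_map L" and d: "d \<noteq> 0"
  shows "cayley d c L (d *s u + c *s L u) = L u"
    and "\<exists>w. u = d *s w + c *s L w"
proof -
  note bij = bij_cayley_denominator[OF L d, of c]
  show "cayley d c L (d *s u + c *s L u) = L u"
    by (simp only: cayley_def comp_apply inv_f_f[OF bij_is_inj[OF bij], of u])
  show "\<exists>w. u = d *s w + c *s L w" using surjD[OF bij_is_surj[OF bij], of u] .
qed

lemma nilpotent_cayley:
  fixes L :: "'a::{field,finite}^'n \<Rightarrow> 'a^'n"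
  assumes L: "nilpotent_map L" and d: "d \<noteq> 0"
  shows "nilpotent_map (cayley d c L)" and "range (cayley d c L) = range L"
proof -
  let ?T = "\<lambda>u. d *s u + c *s L u"
  note bij = bij_cayley_denominator[OF L d, of c]
  have lin: "linear_map L" using L by (simp add: nilpotent_map_def)
  obtain N where N: "L ^^ N = (\<lambda>_. 0)" using L by (auto simp: nilpotent_map_def)
  have linT: "linear_map ?T" using lin by (simp add: linear_map_def algebra_simps vec.scale_right_distrib)
  have linS: "linear_map (inv_into UNIV ?T)" by (rule linear_map_inv[OF linT bij])
  have TL: "?T (L u) = L (?T u)" for u by (simp add: linear_map_add[OF lin] linear_map_scale[OF lin])
  have comm: "L (inv_into UNIV ?T u) = inv_into UNIV ?T (L u)" for u
  proof -
    have "?T (L (inv_into UNIV ?T u)) = L u"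
      unfolding TL using surj_f_inv_f[OF bij_is_surj[OF bij], of u] by simp
    then show ?thesis by (rule inv_f_eq[OF bij_is_inj[OF bij], symmetric])
  qed
  have pow: "(cayley d c L ^^ n) u = (inv_into UNIV ?T ^^ n) ((L ^^ n) u)" for n u
  proof (induction n)
    case (Suc n)
    have commn: "L ((inv_into UNIV ?T ^^ n) w) = (inv_into UNIV ?T ^^ n) (L w)" for w
      by (induction n) (simp_all add: comm)
    show ?case using Suc.IH by (simp add: cayley_def comm commn)
  qed simp
  have "cayley d c L ^^ N = (\<lambda>_. 0)"
    using linear_map_zero[OF linear_map_funpow[OF linS]] by (simp add: fun_eq_iff pow N)
  moreover have "linear_map (cayley d c L)"
    using lin linS by (simp add: linear_map_def cayley_def)
  ultimately show "nilpotent_map (cayley d c L)" by (auto simp: nilpotent_map_def)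
  show "range (cayley d c L) = range L"
    unfolding cayley_def image_comp[symmetric] using bij_is_surj[OF bij_imp_bij_inv[OF bij]] by simp
qed

lemma cayley_inverse:
  fixes L :: "'a::{field,finite}^'n \<Rightarrow> 'a^'n"
  assumes L: "nilpotent_map L" and d: "d \<noteq> 0"
  shows "cayley (1 / d) (- c / d) (cayley d c L) = L"
proof
  fix w
  let ?M = "cayley d c L"
  have M: "nilpotent_map ?M" by (rule nilpotent_cayley[OF L d])
  define v where "v = d *s w + c *s L w"
  have Mv: "?M v = L w" unfolding v_def by (rule cayley_denominator[OF L d])
  have "(1 / d) *s v + (- c / d) *s ?M v = w"
    unfolding Mv unfolding v_def using d by (simp add: vec.scale_right_distrib)
  then show "cayley (1 / d) (- c / d) ?M w = L w"
    using cayley_denominator(1)[OF M, of "1 / d" "- c / d" v] d Mv by simp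
qed

section \<open>Powers of unipotent maps, and fixed points of affine maps\<close>

lemma binomial_funpow:
  assumes L: "linear_map L"
  shows "((\<lambda>u. u + L u) ^^ n) u = (\<Sum>i\<le>n. of_nat (n choose i) *s (L ^^ i) u)"
proof (induction n)
  case (Suc n)
  let ?b = "\<lambda>n i. of_nat (n choose i) :: 'a"
  have Lsum: "L (\<Sum>i\<in>A. f i) = (\<Sum>i\<in>A. L (f i))" for f :: "nat \<Rightarrow> 'a^'b" and A
    by (induction A rule: infinite_finite_induct) (simp_all add: linear_map_add[OF L] linear_map_zero[OF L])
  have "(\<Sum>i\<le>Suc n. ?b n i *s (L ^^ i) u) = (\<Sum>i\<le>n. ?b n i *s (L ^^ i) u)"
    by (simp add: binomial_eq_0)
  then have A: "(\<Sum>i\<le>n. ?b n i *s (L ^^ i) u) = u + (\<Sum>i\<le>n. ?b n (Suc i) *s (L ^^ Suc i) u)"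
    by (subst (asm) sum.atMost_Suc_shift) simp
  have "(\<Sum>i\<le>Suc n. ?b (Suc n) i *s (L ^^ i) u) =
      u + (\<Sum>i\<le>n. ?b n i *s (L ^^ Suc i) u + ?b n (Suc i) *s (L ^^ Suc i) u)"
    by (subst sum.atMost_Suc_shift) (simp add: vec.scale_left_distrib)
  also have "\<dots> = (\<Sum>i\<le>n. ?b n i *s (L ^^ i) u) + L (\<Sum>i\<le>n. ?b n i *s (L ^^ i) u)"
    unfolding sum.distrib Lsum by (simp only: linear_map_scale[OF L] funpow.simps comp_apply A add_ac)
  finally show ?case unfolding funpow.simps comp_apply Suc.IH by (simp only:)
qed simp

lemma freshmans_dream_funpow:
  fixes L :: "'a::field^'n \<Rightarrow> 'a^'n"
  assumes L: "linear_map L" and p: "prime p" "CHAR('a) = p"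
  shows "(\<lambda>u. u + L u) ^^ (p ^ k) = (\<lambda>u. u + (L ^^ (p ^ k)) u)"
proof (induction k)
  case (Suc k)
  \<comment> \<open>The inner binomial coefficients of p vanish in the field. Applying this to M =
    \<open>L ^^ (p ^ k)\<close> gives the induction step.\<close>
  have prime_case: "((\<lambda>u. u + M u) ^^ p) u = u + (M ^^ p) u" if M: "linear_map M" for M :: "'a^'n \<Rightarrow> 'a^'n" and u
  proof -
    have "((\<lambda>u. u + M u) ^^ p) u = (\<Sum>i\<le>p. of_nat (p choose i) *s (M ^^ i) u)"
      by (rule binomial_funpow[OF M])
    also have "\<dots> = (\<Sum>i\<in>{0, p}. of_nat (p choose i) *s (M ^^ i) u)"
    proof (intro sum.mono_neutral_right ballI)
      fix i assume "i \<in> {..p} - {0, p}"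
      then have "p dvd (p choose i)" using p(1) by (intro dvd_choose_prime) auto
      then have "of_nat (p choose i) = (0::'a)" using p(2) of_nat_eq_0_iff_char_dvd by blast
      then show "of_nat (p choose i) *s (M ^^ i) u = 0" by simp
    qed auto
    finally show ?thesis using prime_gt_0_nat[OF p(1)] by simp
  qed
  have "(\<lambda>u. u + L u) ^^ (p ^ Suc k) = (\<lambda>u. u + (L ^^ (p ^ k)) u) ^^ p"
    by (simp add: funpow_mult mult.commute flip: Suc.IH)
  also have "\<dots> = (\<lambda>u. u + (L ^^ (p ^ Suc k)) u)"
    using prime_case[OF linear_map_funpow[OF L, of "p ^ k"]]
    by (simp add: fun_eq_iff funpow_mult mult.commute)
  finally show ?case .
qed simp

lemma derangement_iff:
  fixes v :: "'a::field^'n"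
  shows "derangement (v, a) \<longleftrightarrow> v \<notin> range (\<lambda>u. u v* a - u)"
proof -
  have "u v* a + v = u \<longleftrightarrow> v = (- u) v* a - (- u)" for u
  proof -
    have "(- u) v* a - (- u) = u - u v* a"
      by (simp add: linear_map_minus[OF linear_map_vector_matrix_mult[of a], of u])
    show ?thesis unfolding \<open>(- u) v* a - (- u) = u - u v* a\<close> eq_diff_eq by (simp only: add.commute)
  qed
  then have "\<not> derangement (v, a) \<longleftrightarrow> (\<exists>u. v = (- u) v* a - (- u))"
    by (simp add: derangement_def affine_action_def)
  also have "\<dots> \<longleftrightarrow> v \<in> range (\<lambda>u. u v* a - u)"
  proof -
    have "(\<exists>u. P (- u)) \<longleftrightarrow> (\<exists>u. P u)" for P :: "'a^'n \<Rightarrow> bool" by (metis minus_minus)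
    from this[of "\<lambda>u. v = u v* a - u"] show ?thesis by (simp only: image_iff bex_UNIV)
  qed
  finally show ?thesis by blast
qed

context hermitian_space
begin

section \<open>Isometries as maps and the order of the unitary group\<close>

definition isometry_maps :: "('a^'n \<Rightarrow> 'a^'n) set" where
  "isometry_maps = {f. linear_map f \<and> (\<forall>u v. B (f u) (f v) = B u v)}"

lemma bij_betw_isometries: "bij_betw (\<lambda>a u. u v* a) (isometries B) isometry_maps"
  unfolding bij_betw_def
proof (intro conjI inj_onI equalityI subsetI)
  fix a b :: "'a^'n^'n" assume "(\<lambda>u. u v* a) = (\<lambda>u. u v* b)"
  then have "transpose a *v u = transpose b *v u" for u by (metis transpose_matrix_vector)
  then have "transpose a = transpose b" by (simp add: matrix_eq)
  then show "a = b" by (metis transpose_transpose)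
next
  fix f assume "f \<in> (\<lambda>a u. u v* a) ` isometries B"
  then show "f \<in> isometry_maps"
    by (auto simp: isometries_def isometry_maps_def linear_map_vector_matrix_mult)
next
  fix f assume f: "f \<in> isometry_maps"
  \<comment> \<open>\<open>matrix\<close> describes f on column vectors; the row action needs the
    transpose.\<close>
  define A where "A = matrix f"
  have A: "A *v u = f u" for u
    unfolding A_def using f by (intro matrix_works) (simp add: isometry_maps_def linear_map_iff)
  have "inj f"
  proof (rule injI)
    fix u v assume "f u = f v"
    then have "B u w = B v w" for w using f unfolding isometry_maps_def by (metis (mono_tags, lifting) mem_Collect_eq)
    then show "u = v" by (rule B_eqI_left)
  qed
  moreover have "(*v) A = f" using A by (simp add: fun_eq_iff)
  ultimately have "invertible A"
    using matrix_left_invertible_injective[of A] invertible_left_inverse[of A] by simp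
  then have "invertible (transpose A)"
    by (metis invertible_def matrix_transpose_mul transpose_mat)
  then have "transpose A \<in> isometries B"
    using f A by (simp add: isometries_def isometry_maps_def)
  moreover have "f = (\<lambda>u. u v* transpose A)" using A by (simp add: fun_eq_iff)
  ultimately show "f \<in> (\<lambda>a u. u v* a) ` isometries B" by blast
qed

lemma orthonormal_iff_nth:
  "orthonormal xs \<longleftrightarrow> (\<forall>i<length xs. \<forall>j<length xs. B (xs ! i) (xs ! j) = (if i = j then 1 else 0))"
proof (induction xs)
  case (Cons x xs)
  show ?case
  proof
    assume L: "orthonormal (x # xs)"
    show "\<forall>i<length (x # xs). \<forall>j<length (x # xs). B ((x # xs) ! i) ((x # xs) ! j) = (if i = j then 1 else 0)"
    proof (intro allI impI)
      fix i j assume "i < length (x # xs)" "j < length (x # xs)"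
      then show "B ((x # xs) ! i) ((x # xs) ! j) = (if i = j then 1 else 0)"
        using L Cons.IH B_eq_0_swap[of x] by (cases i; cases j) auto
    qed
  next
    assume R: "\<forall>i<length (x # xs). \<forall>j<length (x # xs). B ((x # xs) ! i) ((x # xs) ! j) = (if i = j then 1 else 0)"
    have "B x x = 1" using R[rule_format, of 0 0] by simp
    moreover have "B v x = 0" if v: "v \<in> set xs" for v
    proof -
      obtain i where "i < length xs" "v = xs ! i" using v by (metis in_set_conv_nth)
      then show ?thesis using R[rule_format, of "Suc i" 0] by simp
    qed
    moreover have "orthonormal xs" unfolding Cons.IH
    proof (intro allI impI)
      fix i j assume "i < length xs" "j < length xs"
      then show "B (xs ! i) (xs ! j) = (if i = j then 1 else 0)"
        using R[rule_format, of "Suc i" "Suc j"] by simp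
    qed
    ultimately show "orthonormal (x # xs)" by simp
  qed
qed simp

lemma independent_indep_list: "indep_list xs \<Longrightarrow> vec.independent (set xs) \<and> distinct xs"
  for xs :: "('a^'n) list"
  by (induction xs) (auto simp: vec.independent_insert vec.span_base vec.independent_empty)

lemma B_eq_on_span:
  assumes f: "linear_map f" and u: "u \<in> vec.span S" and v: "v \<in> vec.span S"
    and S: "\<And>x y. x \<in> S \<Longrightarrow> y \<in> S \<Longrightarrow> B (f x) (f y) = B x y"
  shows "B (f u) (f v) = B u v"
proof -
  have 1: "B (f x) (f v) = B x v" if x: "x \<in> S" for x
  proof -
    have "vec.subspace {v. B (f x) (f v) = B x v}"
      using f by (simp add: vec.subspace_def linear_map_add linear_map_scale linear_map_zero B_simps)
    then have "vec.span S \<subseteq> {v. B (f x) (f v) = B x v}" using x S by (intro vec.span_minimal) auto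
    then show ?thesis using v by blast
  qed
  have "vec.subspace {u. B (f u) (f v) = B u v}"
    using f by (simp add: vec.subspace_def linear_map_add linear_map_scale linear_map_zero B_simps)
  then have "vec.span S \<subseteq> {u. B (f u) (f v) = B u v}" using 1 by (intro vec.span_minimal) auto
  then show ?thesis using u by blast
qed

text \<open>An isometry is determined by the image of a fixed orthonormal basis, which can be any
  orthonormal list of full length.\<close>

lemma card_isometries: "real (card (isometries B)) = unitary_order q CARD('n)"
proof -
  obtain es where es: "orthonormal es" "vec.span (set es) = UNIV" "length es = CARD('n)"
    using nondeg_obtains_orthonormal[OF nondeg_UNIV] dim_subspace_UNIV[where 'a='a and 'n='n] by metis
  let ?L = "{xs. orthonormal xs \<and> set xs \<subseteq> UNIV \<and> length xs = CARD('n)}"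
  have bij: "bij_betw (\<lambda>f. map f es) isometry_maps ?L"
    unfolding bij_betw_def
  proof (intro conjI inj_onI equalityI subsetI)
    fix f g assume fg: "f \<in> isometry_maps" "g \<in> isometry_maps" "map f es = map g es"
    have "vec.subspace {u. f u = g u}"
      using fg by (simp add: isometry_maps_def vec.subspace_def linear_map_add linear_map_scale linear_map_zero)
    then have "vec.span (set es) \<subseteq> {u. f u = g u}" using fg(3) by (intro vec.span_minimal) auto
    then show "f = g" using es(2) by auto
  next
    fix xs assume "xs \<in> (\<lambda>f. map f es) ` isometry_maps"
    then obtain f where f: "f \<in> isometry_maps" "xs = map f es" by blast
    then show "xs \<in> ?L" using es(1,3) by (simp add: orthonormal_iff_nth isometry_maps_def)
  next
    fix xs assume xs: "xs \<in> ?L"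
    have ind: "vec.independent (set es)" "distinct es"
      using independent_indep_list[OF orthonormal_imp_indep[OF es(1)]] by auto
    obtain f where f: "Vector_Spaces.linear (*s) (*s) f"
      "\<And>x. x \<in> set es \<Longrightarrow> f x = the (map_of (zip es xs) x)"
      using vec.linear_independent_extend[OF ind(1), of "\<lambda>x. the (map_of (zip es xs) x)"] by blast
    have lin: "linear_map f" using f(1) by (simp add: linear_map_iff)
    have nth: "f (es ! i) = xs ! i" if "i < CARD('n)" for i
      using that xs es(3) ind(2) f(2)[of "es ! i"] by (simp add: map_of_zip_nth)
    have "B (f u) (f v) = B u v" for u v
    proof (rule B_eq_on_span[OF lin, of _ "set es"])
      fix x y assume "x \<in> set es" "y \<in> set es"
      then obtain i j where "x = es ! i" "y = es ! j" "i < CARD('n)" "j < CARD('n)"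
        by (metis in_set_conv_nth es(3))
      then show "B (f x) (f y) = B x y"
        using xs es(1,3) by (simp add: nth orthonormal_iff_nth)
    qed (simp_all add: es(2))
    then have "f \<in> isometry_maps" using lin by (simp add: isometry_maps_def)
    moreover have "xs = map f es" using nth xs es(3) by (intro nth_equalityI) auto
    ultimately show "xs \<in> (\<lambda>f. map f es) ` isometry_maps" by blast
  qed
  have u0: "unitary_order q 0 = 1" by (simp add: unitary_order_def)
  have "card (isometries B) = card ?L"
    using bij_betw_same_card[OF bij_betw_isometries] bij_betw_same_card[OF bij] by (rule trans)
  then show ?thesis
    using card_orthonormal[OF nondeg_UNIV, of "CARD('n)", unfolded dim_subspace_UNIV] u0
    by (simp only: diff_self_eq_0 mult_1_right order_refl)
qed

text \<open>A unipotent isometry is recorded by its nilpotent part \<open>L = a - 1\<close>.\<close>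

definition unipotent_parts :: "('a^'n \<Rightarrow> 'a^'n) set" where
  "unipotent_parts = {L. nilpotent_map L \<and> (\<forall>u v. B (u + L u) (v + L v) = B u v)}"

lemma linear_map_self_adjoint:
  assumes "x \<in> self_adjoint"
  shows "linear_map x"
  unfolding linear_map_def
  using self_adjoint_add[OF assms] self_adjoint_scale[OF assms] by blast

lemma nilpotent_into_UNIV: "nilpotent_into UNIV = {x. nilpotent_map x \<and> x \<in> self_adjoint}"
  by (auto simp: nilpotent_into_def self_adjoint_into_def nilpotent_map_def linear_map_self_adjoint)

text \<open>With a = 1 + L the denominator is c - c^q a, so the transform is x = (a - 1)/(c - c^q
  a). Taking adjoints replaces a by its inverse and c by c^q, and multiplying numerator and
  denominator by -a gives x back.\<close>

lemma cayley_self_adjoint: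
  assumes L: "L \<in> unipotent_parts" and c: "c ^ q \<noteq> c"
  shows "cayley (c - c ^ q) (- (c ^ q)) L \<in> nilpotent_into UNIV"
proof -
  let ?d = "c - c ^ q"
  have d: "?d \<noteq> 0" using c by simp
  have nil: "nilpotent_map L" and iso: "B (u + L u) (v + L v) = B u v" for u v
    using L by (auto simp: unipotent_parts_def)
  let ?x = "cayley ?d (- (c ^ q)) L"
  have "B (?x u) v = B u (?x v)" for u v
  proof -
    obtain u' where u': "u = ?d *s u' + (- (c ^ q)) *s L u'"
      using cayley_denominator(2)[OF nil d] by blast
    obtain v' where v': "v = ?d *s v' + (- (c ^ q)) *s L v'"
      using cayley_denominator(2)[OF nil d] by blast
    have x: "?x u = L u'" "?x v = L v'"
      unfolding u' v' by (rule cayley_denominator(1)[OF nil d])+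
    have conj: "?d ^ q = - ?d" "(- (c ^ q)) ^ q = - c" by (simp_all add: conj_diff conj_minus)
    \<comment> \<open>The isometry condition in terms of L; it removes the one product not shared by
      both sides.\<close>
    have i: "B u' (L v') = - B (L u') v' - B (L u') (L v')"
    proof -
      have "(B u' v' + B u' (L v')) + (B (L u') v' + B (L u') (L v')) = B u' v'"
        using iso[of u' v'] by (simp only: B_add_left B_add_right add_ac)
      then have "B u' (L v') + (B (L u') v' + B (L u') (L v')) = 0" by (simp only: add.assoc add_cancel_left_right)
      then show ?thesis by (simp only: add_eq_0_iff2) simp
    qed
    show ?thesis unfolding x unfolding u' v'
      by (simp only: B_add_left B_add_right B_scale_left B_scale_right conj i) (simp add: algebra_simps)
  qed
  then show ?thesis
    using nilpotent_cayley(1)[OF nil d] by (simp add: nilpotent_into_UNIV self_adjoint_def)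
qed

text \<open>The inverse transform gives a = 1 + L = (1 + c x)/(1 + c^q x). For self-adjoint x the
  numerator is the adjoint of the denominator and commutes with it, so a preserves the form.\<close>

lemma cayley_unipotent:
  assumes x: "x \<in> nilpotent_into UNIV" and c: "c ^ q \<noteq> c"
  shows "cayley (1 / (c - c ^ q)) (c ^ q / (c - c ^ q)) x \<in> unipotent_parts"
proof -
  let ?d = "c - c ^ q"
  have d: "?d \<noteq> 0" "1 / ?d \<noteq> 0" using c by simp_all
  have nil: "nilpotent_map x" and sa: "B (x u) v = B u (x v)" for u v
    using x by (auto simp: nilpotent_into_UNIV self_adjoint_def)
  let ?L = "cayley (1 / ?d) (c ^ q / ?d) x"
  have "B (u + ?L u) (v + ?L v) = B u v" for u v
  proof -
    have form: "\<exists>w. u = (1 / ?d) *s (w + (c ^ q) *s x w) \<and> u + ?L u = (1 / ?d) *s (w + c *s x w)" for u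
    proof -
      obtain w where w: "u = (1 / ?d) *s w + (c ^ q / ?d) *s x w"
        using cayley_denominator(2)[OF nil d(2)] by blast
      have Lu: "?L u = x w" unfolding w by (rule cayley_denominator(1)[OF nil d(2)])
      have "c / ?d = c ^ q / ?d + 1" using d(1) by (simp add: divide_simps)
      then have "u + ?L u = (1 / ?d) *s w + (c / ?d) *s x w"
        unfolding Lu unfolding w by (simp add: vec.scale_left_distrib)
      then show ?thesis using w by (intro exI[of _ w]) (simp add: vec.scale_right_distrib)
    qed
    obtain u' where u': "u = (1 / ?d) *s (u' + (c ^ q) *s x u')" "u + ?L u = (1 / ?d) *s (u' + c *s x u')"
      using form by blast
    obtain v' where v': "v = (1 / ?d) *s (v' + (c ^ q) *s x v')" "v + ?L v = (1 / ?d) *s (v' + c *s x v')"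
      using form by blast
    have "B (u' + c *s x u') (v' + c *s x v') = B (u' + (c ^ q) *s x u') (v' + (c ^ q) *s x v')"
      by (simp add: B_add_left B_add_right B_scale_left B_scale_right sa algebra_simps)
    moreover have "B u v = B ((1 / ?d) *s (u' + (c ^ q) *s x u')) ((1 / ?d) *s (v' + (c ^ q) *s x v'))"
      by (subst u'(1), subst v'(1)) (rule refl)
    ultimately show ?thesis unfolding u'(2) v'(2) by (simp only: B_scale_left B_scale_right)
  qed
  then show ?thesis
    using nilpotent_cayley(1)[OF nil d(2)] by (simp add: unipotent_parts_def)
qed

lemma sum_unipotent_parts:
  "(\<Sum>L\<in>unipotent_parts. real (card (range L)) ^ s) = nilpotent_weight s UNIV"
proof -
  obtain c :: 'a where c: "c ^ q \<noteq> c" using exists_not_fixed by blast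
  let ?d = "c - c ^ q"
  have d: "?d \<noteq> 0" "1 / ?d \<noteq> 0" using c by simp_all
  have inv1: "cayley (1 / ?d) (c ^ q / ?d) (cayley ?d (- (c ^ q)) L) = L" if "L \<in> unipotent_parts" for L
    using cayley_inverse[OF _ d(1), of L "- (c ^ q)"] that by (simp add: unipotent_parts_def)
  have inv2: "cayley ?d (- (c ^ q)) (cayley (1 / ?d) (c ^ q / ?d) x) = x" if "x \<in> nilpotent_into UNIV" for x
    using cayley_inverse[OF _ d(2), of x "c ^ q / ?d"] that d by (simp add: nilpotent_into_UNIV)
  have range_eq: "range (cayley ?d (- (c ^ q)) L) = range L" if "L \<in> unipotent_parts" for L
    using that d(1) by (intro nilpotent_cayley(2)) (simp_all add: unipotent_parts_def)
  show ?thesis unfolding nilpotent_weight_def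
    by (rule sum.reindex_bij_witness[where i = "cayley (1 / ?d) (c ^ q / ?d)" and j = "cayley ?d (- (c ^ q))"])
      (simp_all add: inv1 inv2 cayley_self_adjoint[OF _ c] cayley_unipotent[OF _ c] range_eq)
qed

section \<open>The affine group\<close>

abbreviation "AU \<equiv> affine_isometry_group B"

lemma affine_pow:
  "affine_action u (g [^]\<^bsub>AU\<^esub> (n::nat)) = ((\<lambda>u. affine_action u g) ^^ n) u"
proof (induction n arbitrary: u)
  case 0
  then show ?case by (simp add: nat_pow_def affine_isometry_group_def affine_action_def)
next
  case (Suc n)
  interpret group AU by (rule group_affine_isometry_group)
  show ?case using Suc.IH by (simp add: nat_pow_Suc affine_action_mult)
qed

lemma affine_action_eq_id_iff:
  assumes "g \<in> carrier AU"
  shows "g = \<one>\<^bsub>AU\<^esub> \<longleftrightarrow> (\<forall>u. affine_action u g = u)"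
proof
  assume R: "\<forall>u. affine_action u g = u"
  obtain v a where g: "g = (v, a)" by (cases g)
  have v: "v = 0" using R[rule_format, of 0] by (simp add: g affine_action_def)
  have "u v* a = u" for u
    using R[rule_format, of u] unfolding g v affine_action_def by simp
  then have "transpose a *v u = transpose (mat 1) *v u" for u
    by (simp only: transpose_matrix_vector vector_matrix_mul_rid)
  then have "transpose a = transpose (mat 1)" by (simp add: matrix_eq)
  then have "a = mat 1" by (metis transpose_transpose)
  then show "g = \<one>\<^bsub>AU\<^esub>" using v by (simp add: g affine_isometry_group_def)
qed (auto simp: affine_isometry_group_def affine_action_def)

text \<open>In characteristic p, \<open>\<phi> ^^ (p ^ k)\<close> sends u to u + L^(p^k) u + t with
  t independent of u. If it is the identity then u = 0 gives t = 0, so L is nilpotent. Conversely,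
  for nilpotent L and large k it is a translation, whose p-th power is trivial.\<close>

lemma ord_prime_power_iff:
  assumes a: "a \<in> isometries B"
  shows "(\<exists>k. group.ord AU (v, a) = p ^ k) \<longleftrightarrow> nilpotent_map (\<lambda>u. u v* a - u)"
proof -
  interpret G: group AU by (rule group_affine_isometry_group)
  define L where "L u = u v* a - u" for u
  define A where "A u = u v* a" for u
  define \<phi> where "\<phi> u = affine_action u (v, a)" for u
  have g: "(v, a) \<in> carrier AU" using a by (simp add: affine_isometry_group_def)
  have linA: "linear_map A" unfolding A_def[abs_def] by (rule linear_map_vector_matrix_mult)
  have linL: "linear_map L"
    unfolding linear_map_def L_def
    by (simp add: vector_matrix_left_distrib scalar_vector_matrix_assoc vec.scale_right_diff_distrib)
  have A: "A = (\<lambda>u. u + L u)" by (simp add: fun_eq_iff A_def L_def)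
  have Apow: "(A ^^ (p ^ k)) u = u + (L ^^ (p ^ k)) u" for k u
    unfolding A freshmans_dream_funpow[OF linL prime_p CHAR_eq] ..
  have \<phi>: "\<phi> u = A u + v" for u by (simp add: \<phi>_def A_def affine_action_def)
  have \<phi>pow: "(\<phi> ^^ n) u = (A ^^ n) u + (\<phi> ^^ n) 0" for n u
    by (induction n) (simp_all add: \<phi> linear_map_add[OF linA] add.assoc)
  have "(\<exists>k. G.ord (v, a) = p ^ k) \<longleftrightarrow> (\<exists>k. G.ord (v, a) dvd p ^ k)"
    using divides_primepow_nat[OF prime_p] by (metis dvd_refl)
  also have "\<dots> \<longleftrightarrow> (\<exists>k. (v, a) [^]\<^bsub>AU\<^esub> (p ^ k) = \<one>\<^bsub>AU\<^esub>)"
    using G.pow_eq_id[OF g] by simp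
  also have "\<dots> \<longleftrightarrow> (\<exists>k. \<forall>u. (\<phi> ^^ (p ^ k)) u = u)"
    using affine_action_eq_id_iff[OF G.nat_pow_closed[OF g]] by (simp add: affine_pow \<phi>_def[abs_def])
  also have "\<dots> \<longleftrightarrow> nilpotent_map L"
  proof
    assume "\<exists>k. \<forall>u. (\<phi> ^^ (p ^ k)) u = u"
    then obtain k where k: "\<And>u. (\<phi> ^^ (p ^ k)) u = u" by blast
    have "(L ^^ (p ^ k)) u = 0" for u using \<phi>pow[of "p ^ k" u] Apow[of k u] k by simp
    then have "L ^^ (p ^ k) = (\<lambda>_. 0)" by (simp add: fun_eq_iff)
    then show "nilpotent_map L" using linL by (auto simp: nilpotent_map_def)
  next
    assume "nilpotent_map L"
    then obtain N where N: "L ^^ N = (\<lambda>_. 0)" by (auto simp: nilpotent_map_def)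
    have "N < p ^ N" using prime_ge_2_nat[OF prime_p] by (intro power_gt_expt) simp
    then have "L ^^ (p ^ N) = L ^^ (p ^ N - N) \<circ> L ^^ N" by (simp flip: funpow_add)
    then have "(L ^^ (p ^ N)) u = 0" for u
      using N linear_map_zero[OF linear_map_funpow[OF linL]] by simp
    then have tr: "(\<phi> ^^ (p ^ N)) u = u + (\<phi> ^^ (p ^ N)) 0" for u
      using \<phi>pow[of "p ^ N" u] Apow[of N u] by simp
    define t where "t = (\<phi> ^^ (p ^ N)) 0"
    have "(\<phi> ^^ (p ^ N)) u = u + t" for u unfolding t_def by (rule tr)
    then have "((\<phi> ^^ (p ^ N)) ^^ n) u = u + of_nat n *s t" for n u
      by (induction n) (simp_all add: vec.scale_left_distrib add_ac)
    then have "(\<phi> ^^ (p ^ Suc N)) u = u + of_nat p *s t" for u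
      by (simp add: funpow_mult mult.commute)
    moreover have "of_nat p = (0::'a)" using CHAR_eq of_nat_CHAR by metis
    \<comment> \<open>The extra factor p in the exponent kills the remaining translation by
      t.\<close>
    ultimately show "\<exists>k. \<forall>u. (\<phi> ^^ (p ^ k)) u = u" by (intro exI[of _ "Suc N"]) simp
  qed
  finally show ?thesis by (simp add: L_def[abs_def])
qed

lemma bij_betw_unipotent:
  "bij_betw (\<lambda>a u. u v* a - u) {a \<in> isometries B. nilpotent_map (\<lambda>u. u v* a - u)} unipotent_parts"
  unfolding bij_betw_def
proof (intro conjI inj_onI equalityI subsetI)
  fix a b assume ab: "a \<in> {a \<in> isometries B. nilpotent_map (\<lambda>u. u v* a - u)}"
    "b \<in> {a \<in> isometries B. nilpotent_map (\<lambda>u. u v* a - u)}"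
    "(\<lambda>u. u v* a - u) = (\<lambda>u. u v* b - u)"
  then have "(\<lambda>u. u v* a) = (\<lambda>u. u v* b)" by (simp add: fun_eq_iff)
  then show "a = b"
    using ab bij_betw_imp_inj_on[OF bij_betw_isometries] by (auto dest: inj_onD)
next
  fix L assume "L \<in> (\<lambda>a u. u v* a - u) ` {a \<in> isometries B. nilpotent_map (\<lambda>u. u v* a - u)}"
  then show "L \<in> unipotent_parts" by (auto simp: unipotent_parts_def isometries_def)
next
  fix L assume L: "L \<in> unipotent_parts"
  then have "linear_map L" by (simp add: unipotent_parts_def nilpotent_map_def)
  then have "(\<lambda>u. u + L u) \<in> isometry_maps"
    using L by (auto simp: isometry_maps_def unipotent_parts_def linear_map_def vec.scale_right_distrib add_ac)
  then obtain a where a: "a \<in> isometries B" "(\<lambda>u. u v* a) = (\<lambda>u. u + L u)"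
    using bij_betw_imp_surj_on[OF bij_betw_isometries] by (metis (no_types, lifting) imageE)
  have "L = (\<lambda>u. u v* a - u)" using fun_cong[OF a(2)] by (simp add: fun_eq_iff)
  then show "L \<in> (\<lambda>a u. u v* a - u) ` {a \<in> isometries B. nilpotent_map (\<lambda>u. u v* a - u)}"
    using a(1) L by (auto simp: unipotent_parts_def)
qed

lemma order_AU: "real (order AU) = real q ^ (2 * CARD('n)) * unitary_order q CARD('n)"
proof -
  have "order AU = CARD('a^'n) * card (isometries B)"
    by (simp only: order_def affine_isometry_group_def partial_object.simps card_cartesian_product)
  moreover have "real CARD('a^'n) = real q ^ (2 * CARD('n))" by (simp add: card_field power_mult)
  ultimately show ?thesis by (simp only: of_nat_mult card_isometries)
qed

text \<open>Over each unipotent a lie q^(2m) - |range (a - 1)| derangements, which combines the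
  cases s = 0 and s = 1.\<close>

lemma card_derangements:
  "real (card {g \<in> carrier AU. derangement g \<and> (\<exists>k. group.ord AU g = p ^ k)}) =
    real q ^ (2 * CARD('n)) * nilpotent_weight 0 UNIV - nilpotent_weight 1 UNIV"
proof -
  let ?U = "{a \<in> isometries B. nilpotent_map (\<lambda>u. u v* a - u)}"
  let ?D = "{g \<in> carrier AU. derangement g \<and> (\<exists>k. group.ord AU g = p ^ k)}"
  have carrier: "carrier AU = UNIV \<times> isometries B" by (simp add: affine_isometry_group_def)
  have "bij_betw prod.swap (SIGMA a:?U. - range (\<lambda>u. u v* a - u)) ?D"
  proof -
    have "?D = {(v, a). a \<in> ?U \<and> v \<notin> range (\<lambda>u. u v* a - u)}"
    proof (rule Set.set_eqI)
      fix g :: "('a^'n) \<times> ('a^'n^'n)"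
      obtain v a where g: "g = (v, a)" by (cases g)
      show "g \<in> ?D \<longleftrightarrow> g \<in> {(v, a). a \<in> ?U \<and> v \<notin> range (\<lambda>u. u v* a - u)}"
        by (cases "a \<in> isometries B") (auto simp: g carrier derangement_iff ord_prime_power_iff simp del: not_ex)
    qed
    then show ?thesis by (simp only:) (rule bij_betwI[where g = prod.swap], auto)
  qed
  from bij_betw_same_card[OF this]
  have "card ?D = card (SIGMA a:?U. - range (\<lambda>u. u v* a - u))" by simp
  also have "\<dots> = (\<Sum>a\<in>?U. card (- range (\<lambda>u. u v* a - u)))"
    by (rule card_SigmaI) auto
  also have "\<dots> = (\<Sum>L\<in>unipotent_parts. card (- range L))"
    by (rule sum.reindex_bij_betw[OF bij_betw_unipotent])
  finally have "real (card ?D) = (\<Sum>L\<in>unipotent_parts. real (card (- range L)))" by simp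
  also have "\<dots> = (\<Sum>L\<in>unipotent_parts. real q ^ (2 * CARD('n)) * real (card (range L)) ^ 0 - real (card (range L)) ^ 1)"
  proof (intro sum.cong refl)
    fix L :: "'a^'n \<Rightarrow> 'a^'n"
    have "card (- range L) = CARD('a^'n) - card (range L)" unfolding Compl_eq_Diff_UNIV by (rule card_Diff_subset) auto
    moreover have "card (range L) \<le> CARD('a^'n)" by (intro card_mono) auto
    moreover have "real CARD('a^'n) = real q ^ (2 * CARD('n))" by (simp add: card_field power_mult)
    ultimately show "real (card (- range L)) =
        real q ^ (2 * CARD('n)) * real (card (range L)) ^ 0 - real (card (range L)) ^ 1"
      by (simp only: of_nat_diff power_0 power_one_right mult_1_right)
  qed
  finally show ?thesis
    unfolding sum_subtractf sum_distrib_left[symmetric] sum_unipotent_parts .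
qed

lemma derangement_proportion:
  "real (card {g \<in> carrier AU. derangement g \<and> (\<exists>k. group.ord AU g = p ^ k)}) / real (order AU) =
    nilpotent_sum (- 1 / real q) 1 CARD('n) - nilpotent_sum (- 1 / real q) ((- 1 / real q) ^ 2) CARD('n)"
proof -
  define m where "m = CARD('n)"
  have dim: "vec.dim (UNIV :: ('a^'n) set) = m" unfolding m_def by (rule dim_subspace_UNIV)
  have w: "nilpotent_weight s UNIV = real q ^ (2 * m * s) * unitary_order q m *
      nilpotent_sum (- 1 / real q) ((- 1 / real q) ^ (2 * s)) m" for s
    using nilpotent_weight_eq[OF nondeg_UNIV, of s, unfolded dim] .
  have w0: "nilpotent_weight 0 UNIV = unitary_order q m * nilpotent_sum (- 1 / real q) 1 m"
    using w[of 0] by (simp only: mult_0_right power_0 mult_1_left)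
  have w1: "nilpotent_weight 1 UNIV = real q ^ (2 * m) * unitary_order q m *
      nilpotent_sum (- 1 / real q) ((- 1 / real q) ^ 2) m"
    using w[of 1] by (simp only: mult_1_right)
  have "real q ^ (2 * m) * unitary_order q m \<noteq> 0" using q_ge_2 unitary_order_nz by simp
  moreover have "real (card {g \<in> carrier AU. derangement g \<and> (\<exists>k. group.ord AU g = p ^ k)}) =
      real q ^ (2 * m) * unitary_order q m *
      (nilpotent_sum (- 1 / real q) 1 m - nilpotent_sum (- 1 / real q) ((- 1 / real q) ^ 2) m)"
    unfolding card_derangements w0 w1 m_def[symmetric] by (simp only: right_diff_distrib mult.assoc)
  ultimately show ?thesis unfolding order_AU m_def[symmetric] by simp
qed

end

theorem theorem1p2:
  fixes p q m :: nat
    and B :: "('a::{field,finite})^'n \<Rightarrow> 'a^'n \<Rightarrow> 'a"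
  assumes "prime p" and "\<exists>k\<ge>1. q = p ^ k"
    and "CARD('a) = q ^ 2" and "m = CARD('n)"
    and "hermitian_form q B" and "nondegenerate B"
  shows "real (card {g \<in> carrier (affine_isometry_group B).
             derangement g \<and> (\<exists>k. group.ord (affine_isometry_group B) g = p ^ k)})
           / real (order (affine_isometry_group B))
         = 1 / (real q ^ m * (real q + 1)) *
           (\<Sum>i=1..m. (-1) ^ i * ((- real q) ^ (i + 1) - 1)
              / ((- real q) ^ (i * (i + 1) div 2) * q_pochhammer (- 1 / real q) (m - i)))"
proof -
  interpret hermitian_space p q B using assms by unfold_locales
  show ?thesis
    unfolding derangement_proportion \<open>m = CARD('n)\<close> by (rule nilpotent_sum_difference[OF q_ge_2])
qed

end
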